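(* Let $(r(n))_{n\in\mathbb{N}_0}$ be the Rudin–Shapiro sequence and for $a\in\{0,1\}$ let $R_a=\{n\in\mathbb{N} : r(n)=a\}$. Then $R_a$ is $U^\infty(\Phi)$-uniform for any Følner sequence $\Phi$ in $\mathbb{N}$. In particular, there exists a sequence of infinite sets $B_1\supset B_2\supset\cdots$ of natural numbers such that $$\bigcup_{k\in\mathbb{N}}B_k^{\oplus k}\subset R_a.$$
   Context: $\mathbb{N}=\{1,2,\dots\}$; $B^{\oplus \ell}=\{b_1+\cdots+b_\ell : b_i\in B,\ b_1<\cdots<b_\ell\}$. $r(n)$ is the number of (possibly overlapping) blocks $11$ in the binary expansion of $n$, modulo $2$. A Følner sequence $\Phi=(\Phi_N)$ is a sequence of finite (nonempty) subsets of $\mathbb{N}$ with $|\Phi_N\triangle(\Phi_N+t)|/|\Phi_N|\to0$ for every $t\in\mathbb{N}$; $\mathrm{d}_\Phi(A)=\lim_N|A\cap\Phi_N|/|\Phi_N|$ when it exists. A bounded $\phi:\mathbb{N}\to\mathbb{C}$ admits correlations along $\Phi$ if $\lim_N\frac{1}{|\Phi_N|}\sum_{n\in\Phi_N}\prod_{i=1}^m C^{\epsilon_i}\phi(n+h_i)$ exists for all $m$, $h_i\in\mathbb{N}$, $\epsilon_i\in\{0,1\}$ ($C$ = complex conjugation). For such $\phi$: $\|\phi\|_{U^0(\Phi)}=\lim_{N}\frac{1}{|\Phi_N|}\sum_{n\in\Phi_N}\phi(n)$ and $\|\phi\|_{U^{k+1}(\Phi)}^{2^{k+1}}=\lim_{H\to\infty}\frac1H\sum_{h=1}^H\|\Delta_h\phi\|_{U^k(\Phi)}^{2^k}$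 with $(\Delta_h\phi)(n)=\phi(n)\overline{\phi(n+h)}$. A set $A\subset\mathbb{N}$ is $U^k(\Phi)$-uniform if $\mathbf{1}_A$ admits correlations along $\Phi$, $\mathrm{d}_\Phi(A)>0$ and $\|\mathbf{1}_A-\mathrm{d}_\Phi(A)\|_{U^k(\Phi)}=0$; it is $U^\infty(\Phi)$-uniform if it is $U^k(\Phi)$-uniform for all $k\in\mathbb{N}$. *)

theory Defs
  imports "HOL-Analysis.Analysis"
begin

text \<open>
  Throughout, \<open>\<nat> = {1, 2, \<dots>}\<close>. It is rendered by the type \<^typ>\<open>nat\<close> together with explicit
  side conditions excluding \<open>0\<close>; the value at \<open>0\<close> of a function on \<open>\<nat>\<close> is never used.
\<close>

definition rudin_shapiro :: "nat \<Rightarrow> nat" where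
  "rudin_shapiro n = card {i. bit n i \<and> bit n (Suc i)} mod 2"

definition RS :: "nat \<Rightarrow> nat set" where
  "RS a = {n. n \<ge> 1 \<and> rudin_shapiro n = a}"

definition osum :: "nat set \<Rightarrow> nat \<Rightarrow> nat set" where
  "osum B l = {\<Sum>i=1..l. b i | b. (\<forall>i\<in>{1..l}. b i \<in> B) \<and> strict_mono_on {1..l} b}"

definition folner :: "(nat \<Rightarrow> nat set) \<Rightarrow> bool" where
  "folner \<Phi> \<longleftrightarrow>
     (\<forall>N. finite (\<Phi> N) \<and> \<Phi> N \<noteq> {} \<and> \<Phi> N \<subseteq> {1..}) \<and>
     (\<forall>t\<ge>1. (\<lambda>N. real (card (sym_diff (\<Phi> N) ((\<lambda>n. n + t) ` \<Phi> N))) / real (card (\<Phi> N)))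
               \<longlonglongrightarrow> 0)"

definition has_density :: "(nat \<Rightarrow> nat set) \<Rightarrow> nat set \<Rightarrow> real \<Rightarrow> bool" where
  "has_density \<Phi> A d \<longleftrightarrow> (\<lambda>N. real (card (A \<inter> \<Phi> N)) / real (card (\<Phi> N))) \<longlonglongrightarrow> d"

definition avg :: "nat set \<Rightarrow> (nat \<Rightarrow> complex) \<Rightarrow> complex" where
  "avg F \<phi> = (\<Sum>n\<in>F. \<phi> n) / of_nat (card F)"

definition admits_correlations :: "(nat \<Rightarrow> nat set) \<Rightarrow> (nat \<Rightarrow> complex) \<Rightarrow> bool" where
  "admits_correlations \<Phi> \<phi> \<longleftrightarrow>
     bounded (\<phi> ` {1..}) \<and>
     (\<forall>m\<ge>1::nat. \<forall>h e. (\<forall>i\<in>{1..m}. h i \<ge> (1::nat) \<and> e i \<in> {0, 1::nat}) \<longrightarrow>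
        convergent (\<lambda>N. avg (\<Phi> N) (\<lambda>n. \<Prod>i=1..m. (cnj ^^ e i) (\<phi> (n + h i)))))"

definition mult_diff :: "nat \<Rightarrow> (nat \<Rightarrow> complex) \<Rightarrow> nat \<Rightarrow> complex" where
  "mult_diff h \<phi> n = \<phi> n * cnj (\<phi> (n + h))"

text \<open>
  \<open>has_U_norm \<Phi> k \<phi> x\<close> means that all the limits in the recursive definition of the
  \<open>U\<^sup>k(\<Phi>)\<close>-seminorm of \<open>\<phi>\<close> exist and that its value is \<open>x\<close>. For \<open>k = 0\<close> the value is an
  arbitrary complex number; for \<open>k \<ge> 1\<close> it is the nonnegative \<open>2\<^sup>k\<close>-th root of the limit.
\<close>
fun has_U_norm :: "(nat \<Rightarrow> nat set) \<Rightarrow> nat \<Rightarrow> (nat \<Rightarrow> complex) \<Rightarrow> complex \<Rightarrow> bool" where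
  "has_U_norm \<Phi> 0 \<phi> x \<longleftrightarrow> (\<lambda>N. avg (\<Phi> N) \<phi>) \<longlonglongrightarrow> x"
| "has_U_norm \<Phi> (Suc k) \<phi> x \<longleftrightarrow>
     x \<in> \<real>\<^sub>\<ge>\<^sub>0 \<and>
     (\<exists>w. (\<forall>h\<ge>1. has_U_norm \<Phi> k (mult_diff h \<phi>) (w h)) \<and>
          (\<lambda>H. avg {1..H} (\<lambda>h. w h ^ 2 ^ k)) \<longlonglongrightarrow> x ^ 2 ^ Suc k)"

lemma has_U_norm_unique:
  assumes "has_U_norm \<Phi> k \<phi> x" "has_U_norm \<Phi> k \<phi> y"
  shows "x = y"
  using assms
proof (induction k arbitrary: \<phi> x y)
  case 0
  then show ?case by (auto intro: LIMSEQ_unique)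
next
  case (Suc k)
  from Suc.prems(1) obtain v where v: "\<And>h. h \<ge> 1 \<Longrightarrow> has_U_norm \<Phi> k (mult_diff h \<phi>) (v h)"
    "(\<lambda>H. avg {1..H} (\<lambda>h. v h ^ 2 ^ k)) \<longlonglongrightarrow> x ^ 2 ^ Suc k" and x: "x \<in> \<real>\<^sub>\<ge>\<^sub>0" by auto
  from Suc.prems(2) obtain w where w: "\<And>h. h \<ge> 1 \<Longrightarrow> has_U_norm \<Phi> k (mult_diff h \<phi>) (w h)"
    "(\<lambda>H. avg {1..H} (\<lambda>h. w h ^ 2 ^ k)) \<longlonglongrightarrow> y ^ 2 ^ Suc k" and y: "y \<in> \<real>\<^sub>\<ge>\<^sub>0" by auto
  have "v h = w h" if "h \<ge> 1" for h
    using Suc.IH v(1) w(1) that by blast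
  then have "avg {1..H} (\<lambda>h. v h ^ 2 ^ k) = avg {1..H} (\<lambda>h. w h ^ 2 ^ k)" for H
    unfolding avg_def by (intro arg_cong2[where f = "(/)"] sum.cong) auto
  with v(2) w(2) have eq: "x ^ 2 ^ Suc k = y ^ 2 ^ Suc k"
    by (auto intro: LIMSEQ_unique)
  obtain a b where ab: "x = of_real a" "a \<ge> 0" "y = of_real b" "b \<ge> 0"
    using x y by (auto elim!: nonneg_Reals_cases)
  with eq have "a ^ 2 ^ Suc k = b ^ 2 ^ Suc k"
    by (metis of_real_eq_iff of_real_power)
  with ab have "a = b"
    using power_eq_imp_eq_base[of a "2 ^ Suc k" b] by simp
  with ab show ?case by simp
qed

definition U_uniform :: "(nat \<Rightarrow> nat set) \<Rightarrow> nat \<Rightarrow> nat set \<Rightarrow> bool" where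
  "U_uniform \<Phi> k A \<longleftrightarrow>
     admits_correlations \<Phi> (indicator A) \<and>
     (\<exists>d. has_density \<Phi> A d \<and> d > 0 \<and>
          has_U_norm \<Phi> k (\<lambda>n. indicator A n - complex_of_real d) 0)"

definition U_infinity_uniform :: "(nat \<Rightarrow> nat set) \<Rightarrow> nat set \<Rightarrow> bool" where
  "U_infinity_uniform \<Phi> A \<longleftrightarrow> (\<forall>k\<ge>1. U_uniform \<Phi> k A)"

end

theory Submission
  imports Defs
begin

text \<open>
  Write \<open>s(n) = (-1)\<^sup>r\<^sup>(\<^sup>n\<^sup>)\<close>. If \<open>u < 2\<^sup>B\<close>, then \<open>s(u + 2\<^sup>B Y) = \<plusminus> s(u) s(Y)\<close>, where the sign is
  negative only if the top digit of \<open>u\<close> and the bottom digit of \<open>Y\<close> are both \<open>1\<close>. Hence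
  \<open>s(n) s(n + h)\<close> is \<open>2\<^sup>M\<close>-periodic off a set of density \<open>O(h / 2\<^sup>M)\<close>, so all seminorms of
  \<open>\<Delta>\<^sub>h s\<close> exist and are limits of averages over cubes in \<open>\<int>/2\<^sup>M\<close>. For
  \<open>h\<close> in a dyadic block these averages tend to \<open>0\<close>: in each window of consecutive digits of
  \<open>(n, h\<^sub>1, \<dots>, h\<^sub>k)\<close>, exchanging an all-zero pattern with a suitable zero-padded one flips the sign
  of \<open>\<Prod>\<^sub>\<omega> s(n + \<omega> \<cdot> h)\<close>, and most tuples meet such a window. The pattern comes from a
  \<open>c\<close> with \<open>s(j c) = 1\<close> for \<open>j < k\<close> and \<open>s(k c) = -1\<close>, which exists for odd \<open>k\<close>.

  Multipliers of this kind also give the sets \<open>B\<^sub>k = {g\<^sub>i : i \<ge> k}\<close> directly: each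
  \<open>g\<^sub>N\<^sub>+\<^sub>1\<close> is \<open>g\<^sub>N\<close> plus a block \<open>\<delta>\<close> of much higher digits such that
  adding up to \<open>N\<close> copies of \<open>\<delta>\<close> does not change \<open>r\<close>, while \<open>r((N + 1) g\<^sub>N\<^sub>+\<^sub>1)\<close> is as wanted.
\<close>

section \<open>Signs of the Rudin--Shapiro sequence\<close>

definition rs_sign :: "nat \<Rightarrow> real" where
  "rs_sign n = (-1) ^ rudin_shapiro n"

lemma finite_ones: "finite {i. bit (n::nat) i \<and> bit n (Suc i)}"
proof (rule finite_subset)
  show "{i. bit n i \<and> bit n (Suc i)} \<subseteq> {..<n}"
  proof
    fix i assume "i \<in> {i. bit n i \<and> bit n (Suc i)}"
    then have "n div 2 ^ i \<noteq> 0" by (auto simp: bit_iff_odd intro: ccontr)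
    then have "2 ^ i \<le> n" by (meson div_less not_less)
    then show "i \<in> {..<n}" using less_le_trans[OF less_exp[of i]] by simp
  qed
qed simp

lemma rs_sign_alt: "rs_sign n = (-1) ^ card {i. bit n i \<and> bit n (Suc i)}"
  unfolding rs_sign_def rudin_shapiro_def by (simp add: minus_one_power_iff)

lemma rs_sign_0 [simp]: "rs_sign 0 = 1"
  by (simp add: rs_sign_alt)

lemma rs_sign_double: "rs_sign (2 * n) = rs_sign n"
proof -
  have "{i. bit (2 * n) i \<and> bit (2 * n) (Suc i)} = Suc ` {i. bit n i \<and> bit n (Suc i)}"
    by (auto simp: bit_double_iff image_iff gr0_conv_Suc Suc_le_eq)
  then show ?thesis by (simp add: rs_sign_alt card_image)
qed

lemma rs_sign_double_Suc: "rs_sign (Suc (2 * n)) = rs_sign n * (-1) ^ n"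
proof -
  have *: "{i. bit (Suc (2 * n)) i \<and> bit (Suc (2 * n)) (Suc i)} =
      Suc ` {i. bit n i \<and> bit n (Suc i)} \<union> (if odd n then {0} else {})"
  proof (rule set_eqI)
    fix i
    show "i \<in> {i. bit (Suc (2 * n)) i \<and> bit (Suc (2 * n)) (Suc i)} \<longleftrightarrow>
      i \<in> Suc ` {i. bit n i \<and> bit n (Suc i)} \<union> (if odd n then {0} else {})"
      by (cases i) (auto simp: bit_Suc bit_0)
  qed
  show ?thesis unfolding rs_sign_alt *
    using finite_ones[of n] by (auto simp: card_image card_insert_if minus_one_power_iff)
qed

lemma rs_sign_cases: "rs_sign n = 1 \<or> rs_sign n = -1"
  unfolding rs_sign_def by (simp add: minus_one_power_iff)

lemma abs_rs_sign [simp]: "\<bar>rs_sign n\<bar> = 1"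
  using rs_sign_cases[of n] by auto

lemma rs_sign_mult_self [simp]: "rs_sign n * rs_sign n = 1"
  using rs_sign_cases[of n] by auto

lemma rs_sign_1: "rs_sign (Suc 0) = 1"
  using rs_sign_double_Suc[of 0] by simp

text \<open>\<open>2 ^ B \<le> 2 * u\<close> says that the top one of the \<open>B\<close> digits of
  \<open>u\<close> is 1, so the last factor accounts for a block 11 straddling the cut. The
  induction strips the lowest digit of \<open>u\<close>.\<close>

lemma rs_sign_split:
  assumes "u < 2 ^ B"
  shows "rs_sign (u + 2 ^ B * Y) =
    rs_sign u * rs_sign Y * (if 2 ^ B \<le> 2 * u \<and> odd Y then -1 else 1)"
  using assms
proof (induction B arbitrary: u)
  case 0
  then show ?case by simp
next
  case (Suc B)
  show ?case
  \<comment> \<open>With a single low digit, that digit borders \<open>Y\<close> itself. Otherwise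
    \<open>2 ^ B\<close> is even and the lowest digit of \<open>u\<close> only meets
    \<open>v\<close>.\<close>
  proof (cases "B = 0")
    case True
    with Suc.prems have "u = 0 \<or> u = Suc 0" by auto
    then show ?thesis using True
      by (auto simp: rs_sign_double rs_sign_double_Suc rs_sign_1 minus_one_power_iff)
  next
    case False
    define v where "v = u div 2"
    have v: "v < 2 ^ B" using Suc.prems by (auto simp: v_def)
    have ev: "even ((2::nat) ^ B)" using False by simp
    from Suc.IH[OF v] have IH: "rs_sign (v + 2 ^ B * Y) =
      rs_sign v * rs_sign Y * (if 2 ^ B \<le> 2 * v \<and> odd Y then -1 else 1)" .
    show ?thesis
    proof (cases "even u")
      case True
      then have u: "u = 2 * v" by (simp add: v_def)
      have "u + 2 ^ Suc B * Y = 2 * (v + 2 ^ B * Y)" by (simp add: u algebra_simps)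
      then have "rs_sign (u + 2 ^ Suc B * Y) = rs_sign (v + 2 ^ B * Y)"
        by (simp only: rs_sign_double)
      then show ?thesis by (simp add: rs_sign_double IH u)
    next
      case odd: False
      then have u: "u = Suc (2 * v)" by (simp add: v_def)
      have "u + 2 ^ Suc B * Y = Suc (2 * (v + 2 ^ B * Y))" by (simp add: u algebra_simps)
      moreover have le: "2 ^ Suc B \<le> 2 * u \<longleftrightarrow> 2 ^ B \<le> 2 * v"
        using ev unfolding u power_Suc by presburger
      moreover have "(- 1 :: real) ^ (v + 2 ^ B * Y) = (- 1) ^ v"
        using ev by (simp add: minus_one_power_iff)
      ultimately have "rs_sign (u + 2 ^ Suc B * Y) = rs_sign (v + 2 ^ B * Y) * (-1) ^ v"
        by (simp only: rs_sign_double_Suc)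
      then show ?thesis using le by (simp add: rs_sign_double_Suc IH u)
    qed
  qed
qed

lemma rs_sign_concat:
  assumes "2 * u < 2 ^ B"
  shows "rs_sign (u + 2 ^ B * Y) = rs_sign u * rs_sign Y"
  using rs_sign_split[of u B Y] assms by simp

lemma rs_sign_shift: "rs_sign (2 ^ B * Y) = rs_sign Y"
  using rs_sign_concat[of 0 B Y] by simp

lemma ex_power2_gt: "\<exists>B. (n::nat) < 2 ^ B"
  using less_exp by blast

text \<open>With \<open>2\<^sup>m\<^sup>-\<^sup>1 < k c < 2\<^sup>m\<close> and \<open>j c < 2\<^sup>m\<^sup>-\<^sup>1\<close> for \<open>j < k\<close>, only for \<open>j = k\<close> do the two parts of
  \<open>j (c + 2\<^sup>m)\<close> interact; appending \<open>c\<close> and \<open>1\<close> once more squares away all other signs.\<close>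
lemma ex_isolating_multiplier:
  assumes "odd k"
  shows "\<exists>c>0. (\<forall>j<k. rs_sign (j * c) = 1) \<and> rs_sign (k * c) = -1"
proof -
  have k: "k > 0" using assms by (cases k) auto
  define m where "m = Suc (2 * k)"
  define P where "P = (2::nat) ^ (2 * k)"
  \<comment> \<open>The least \<open>c\<close> with \<open>k * c > P\<close>. The size of
    \<open>P\<close> makes \<open>c > k\<close>, so the overshoot \<open>k * c - P \<le> k\<close>
    is smaller than \<open>c\<close> and \<open>(k - 1) * c\<close> stays below
    \<open>P\<close>.\<close>
  define c where "c = P div k + 1"
  have kk: "k * k < P"
  proof -
    have "k * k < 2 ^ k * 2 ^ k" using less_exp[of k] k by (intro mult_strict_mono) auto
    then show ?thesis by (simp add: P_def power_add mult_2)
  qed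
  have dm: "P div k * k + P mod k = P" by simp
  have mlt: "P mod k < k" using k by simp
  have kc_ge: "P < k * c" 
  proof -
    have "k * c = P div k * k + k" by (simp add: c_def)
    then show ?thesis using dm mlt by linarith
  qed
  have kc_lt: "k * c < 2 * P"
  proof -
    have "k * c \<le> P + k" using dm by (simp add: c_def algebra_simps)
    moreover have "k \<le> k * k" by simp
    ultimately show ?thesis using kk by linarith
  qed
  have jc_lt: "j * c < P" if "j < k" for j
  proof (cases "j = 0")
    case True then show ?thesis by (simp add: P_def)
  next
    case False
    have "P div k \<ge> k" using kk k by (simp add: less_eq_div_iff_mult_less_eq)
    have "j * c \<le> (k - 1) * c" using that by (intro mult_right_mono) auto
    also have "\<dots> = k * c - c" by (simp add: diff_mult_distrib)
    also have "\<dots> < P"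
    proof -
      have "k * c \<le> P + k" using dm by (simp add: c_def algebra_simps)
      moreover have "c > k" using \<open>P div k \<ge> k\<close> by (simp add: c_def)
      moreover have "P > 0" by (simp add: P_def)
      ultimately show ?thesis by linarith
    qed
    finally show ?thesis .
  qed
  have Pm: "2 ^ m = 2 * P" by (simp add: m_def P_def)
  have le: "j * c < 2 ^ m" if "j \<le> k" for j
    using that jc_lt[of j] kc_lt by (cases "j = k") (auto simp: Pm)
  have inter: "rs_sign (j * (c + 2 ^ m)) = rs_sign (j * c) * rs_sign j * (if j = k then -1 else 1)"
    if "j \<le> k" for j
  proof -
    have "rs_sign (j * (c + 2 ^ m)) = rs_sign (j * c + 2 ^ m * j)" by (simp add: algebra_simps)
    also have "\<dots> = rs_sign (j * c) * rs_sign j * (if 2 ^ m \<le> 2 * (j * c) \<and> odd j then -1 else 1)"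
      using le[OF that] by (rule rs_sign_split)
    \<comment> \<open>As \<open>2 ^ m = 2 * P\<close>, the comparison is
      \<open>P \<le> j * c\<close>, which singles out \<open>j = k\<close>; oddness of
      \<open>k\<close> supplies the digit 1 on the upper side.\<close>
    also have "(2 ^ m \<le> 2 * (j * c) \<and> odd j) \<longleftrightarrow> j = k"
      using that jc_lt[of j] kc_ge assms by (cases "j = k") (auto simp: Pm)
    finally show ?thesis .
  qed
  obtain M where M: "2 * (k * (c + 2 ^ m)) < 2 ^ M" using ex_power2_gt by blast
  define e where "e = (c + 2 ^ m) + 2 ^ M * (c + 2 ^ M)"
  have "rs_sign (j * e) = (if j = k then -1 else 1)" if "j \<le> k" for j
  proof -
    have b1: "2 * (j * (c + 2 ^ m)) < 2 ^ M"
      using M mult_le_mono1[OF that, of "c + 2 ^ m"] by linarith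
    have b2: "2 * (j * c) < 2 ^ M" using b1 by (simp add: algebra_simps)
    have "j * e = j * (c + 2 ^ m) + 2 ^ M * (j * c + 2 ^ M * j)" by (simp add: e_def algebra_simps)
    then have "rs_sign (j * e) = rs_sign (j * (c + 2 ^ m)) * (rs_sign (j * c) * rs_sign j)"
      by (simp only: rs_sign_concat[OF b1] rs_sign_concat[OF b2])
    also have "\<dots> = (rs_sign (j * c) * rs_sign (j * c)) * (rs_sign j * rs_sign j) * (if j = k then -1 else 1)"
      unfolding inter[OF that] by (simp only: ac_simps)
    finally show ?thesis by simp
  qed
  then show ?thesis by (intro exI[of _ e]) (auto simp: e_def c_def)
qed

subsection \<open>Sets with ordered sums in a given class\<close>

text \<open>\<open>h - g\<close> is the block appended to \<open>g\<close>. The range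
  \<open>u \<le> N * g\<close> covers every sum of at most \<open>N\<close> terms not exceeding
  \<open>g\<close>, which is how \<open>truncated_sum_sign\<close> uses it.\<close>

definition extends :: "real \<Rightarrow> nat \<Rightarrow> nat \<Rightarrow> nat \<Rightarrow> bool" where
  "extends \<eta> N g h \<longleftrightarrow> g < h \<and> rs_sign (Suc N * h) = \<eta> \<and>
     (\<forall>n\<le>N. \<forall>u\<le>N * g. rs_sign (u + n * (h - g)) = rs_sign u)"

lemma ex_extends:
  assumes \<eta>: "\<eta> = 1 \<or> \<eta> = -1" and g: "\<And>j. 1 \<le> j \<Longrightarrow> j \<le> N \<Longrightarrow> rs_sign (j * g) = \<eta>"
  shows "\<exists>h. extends \<eta> N g h"
proof -
  have "\<exists>c>0. (\<forall>j\<le>N. rs_sign (j * c) = 1) \<and> rs_sign (Suc N * g) * rs_sign (Suc N * c) = \<eta>"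
  proof (cases "rs_sign (Suc N * g) = \<eta>")
    case True
    \<comment> \<open>\<open>2 * N + 3\<close> is odd and exceeds \<open>Suc N\<close>, so
      \<open>c\<close> gives sign 1 to all multiples up to \<open>Suc N\<close>.\<close>
    obtain c where c: "c > 0" "\<And>j. j < 2 * N + 3 \<Longrightarrow> rs_sign (j * c) = 1"
      using ex_isolating_multiplier[of "2 * N + 3"] by auto
    show ?thesis using c(1) c(2)[of "Suc N"] True by (intro exI[of _ c]) (auto intro!: c(2))
  next
    case False
    have "odd (Suc N)"
    proof
      assume "even (Suc N)"
      then obtain i where i: "Suc N = 2 * i" by (elim evenE)
      then have "rs_sign (Suc N * g) = rs_sign (i * g)"
        using rs_sign_double[of "i * g"] by (simp add: mult.assoc)
      also have "\<dots> = \<eta>" using i by (intro g) auto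
      finally show False using False by simp
    qed
    then obtain c where c: "c > 0" "\<And>j. j < Suc N \<Longrightarrow> rs_sign (j * c) = 1" "rs_sign (Suc N * c) = -1"
      using ex_isolating_multiplier[of "Suc N"] by auto
    have "rs_sign (Suc N * g) = - \<eta>" using rs_sign_cases[of "Suc N * g"] False \<eta> by auto
    then show ?thesis using c by (intro exI[of _ c]) auto
  qed
  then obtain c where c: "c > 0" "\<And>j. j \<le> N \<Longrightarrow> rs_sign (j * c) = 1"
    "rs_sign (Suc N * g) * rs_sign (Suc N * c) = \<eta>" by blast
  obtain M where M: "2 * (Suc N * g) < 2 ^ M" using ex_power2_gt by blast
  have "rs_sign (Suc N * (g + 2 ^ M * c)) = rs_sign (Suc N * g + 2 ^ M * (Suc N * c))"
    by (simp add: algebra_simps)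
  also have "\<dots> = \<eta>" by (simp only: rs_sign_concat[OF M] c(3))
  moreover have "rs_sign (u + n * (2 ^ M * c)) = rs_sign u" if "n \<le> N" "u \<le> N * g" for n u
  proof -
    have "2 * u < 2 ^ M" using M that(2) by simp
    from rs_sign_concat[OF this, of "n * c"] c(2)[OF that(1)] show ?thesis
      by (simp add: mult.left_commute)
  qed
  ultimately show ?thesis using c(1) unfolding extends_def
    by (intro exI[of _ "g + 2 ^ M * c"]) auto
qed

text \<open>Dependent choice along the invariant \<open>?P N g\<close>, vacuous for
  \<open>N = 0\<close>. It passes from \<open>g\<close> to \<open>h\<close> because
  \<open>j * h\<close> is \<open>j * g\<close> plus \<open>j\<close> copies of the block;
  \<open>extends\<close> itself provides \<open>j = Suc N\<close>.\<close>

lemma ex_extending_sequence: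
  assumes \<eta>: "\<eta> = 1 \<or> \<eta> = -1"
  shows "\<exists>g :: nat \<Rightarrow> nat. \<forall>N. extends \<eta> N (g N) (g (Suc N))"
proof -
  let ?P = "\<lambda>N g. \<forall>j. 1 \<le> j \<longrightarrow> j \<le> N \<longrightarrow> rs_sign (j * g) = \<eta>"
  have step: "\<exists>h. ?P (Suc N) h \<and> extends \<eta> N g h" if P: "?P N g" for N g
  proof -
    obtain h where h: "extends \<eta> N g h" using ex_extends[OF \<eta>, of N g] P by blast
    have "?P (Suc N) h"
    proof (intro allI impI)
      fix j assume j: "1 \<le> j" "j \<le> Suc N"
      show "rs_sign (j * h) = \<eta>"
      proof (cases "j = Suc N")
        case True
        then show ?thesis using h by (simp only: extends_def)
      next
        case False
        with j have jN: "j \<le> N" by simp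
        have "rs_sign (j * g + j * (h - g)) = rs_sign (j * g)"
          using h jN by (auto simp: extends_def)
        moreover have "j * g + j * (h - g) = j * h"
          using h by (simp add: extends_def flip: distrib_left)
        ultimately show ?thesis using P j jN by simp
      qed
    qed
    with h show ?thesis by blast
  qed
  have "\<exists>g. \<forall>N. ?P N (g N) \<and> extends \<eta> N (g N) (g (Suc N))"
    by (rule dependent_nat_choice) (use step in auto)
  then show ?thesis by blast
qed

text \<open>Indices are capped at level \<open>k + m\<close>. At \<open>m = 0\<close> all terms are
  equal and the sum is \<open>k * g k\<close>. Raising the cap from \<open>N\<close> to
  \<open>Suc N\<close> adds at most \<open>k \<le> N\<close> copies of one block to a sum of size at
  most \<open>N * g N\<close>, which keeps the sign.\<close>

lemma truncated_sum_sign: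
  fixes g :: "nat \<Rightarrow> nat"
  assumes ext: "\<And>N. extends \<eta> N (g N) (g (Suc N))" and I: "finite I" "card I = k" "k \<ge> 1"
    and i: "\<And>j. j \<in> I \<Longrightarrow> k \<le> i j"
  shows "rs_sign (\<Sum>j\<in>I. g (min (i j) (k + m))) = \<eta>"
proof (induction m)
  case 0
  obtain l where l: "k = Suc l" using I(3) by (cases k) auto
  have "(\<Sum>j\<in>I. g (min (i j) (k + 0))) = Suc l * g (Suc l)"
    using i I l by (simp add: min_absorb2)
  then show ?case using ext[of l] by (simp only: extends_def)
next
  case (Suc m)
  define N where "N = k + m"
  have mono: "g a \<le> g b" if "a \<le> b" for a b
    by (rule lift_Suc_mono_le[OF _ that]) (use ext in \<open>auto simp: extends_def intro: less_imp_le\<close>)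
  let ?J = "{j\<in>I. N < i j}"
  have "g (min (i j) (Suc N)) = g (min (i j) N) + (if N < i j then g (Suc N) - g N else 0)" for j
    using mono[of N "Suc N"] by (auto simp: min_def not_less_eq_eq le_Suc_eq)
  then have "(\<Sum>j\<in>I. g (min (i j) (Suc N))) = (\<Sum>j\<in>I. g (min (i j) N)) + card ?J * (g (Suc N) - g N)"
    using I(1) by (simp add: sum.distrib sum.If_cases Int_def)
  moreover have "card ?J \<le> N" using card_mono[of I ?J] I by (auto simp: N_def)
  moreover have "(\<Sum>j\<in>I. g (min (i j) N)) \<le> N * g N"
  proof -
    have "(\<Sum>j\<in>I. g (min (i j) N)) \<le> (\<Sum>j\<in>I. g N)" by (intro sum_mono mono) simp
    also have "\<dots> \<le> N * g N" using I by (simp add: N_def)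
    finally show ?thesis .
  qed
  ultimately have "rs_sign (\<Sum>j\<in>I. g (min (i j) (Suc N))) = rs_sign (\<Sum>j\<in>I. g (min (i j) N))"
    using ext[of N] unfolding extends_def by simp
  then show ?case using Suc by (simp add: N_def)
qed

lemma RS_iff:
  assumes "a \<in> {0, 1}"
  shows "n \<in> RS a \<longleftrightarrow> n \<ge> 1 \<and> rs_sign n = (-1) ^ a"
proof -
  have "rudin_shapiro n < 2" by (simp add: rudin_shapiro_def)
  then have "rudin_shapiro n = 0 \<or> rudin_shapiro n = 1" by auto
  then show ?thesis using assms by (auto simp: RS_def rs_sign_def)
qed

lemma ex_ordered_sums_in_RS:
  assumes a: "a \<in> {0, 1}"
  shows "\<exists>B :: nat \<Rightarrow> nat set.
            (\<forall>k\<ge>1. B k \<subseteq> {1..} \<and> infinite (B k) \<and> B (Suc k) \<subseteq> B k) \<and>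
            (\<Union>k\<in>{1..}. osum (B k) k) \<subseteq> RS a"
proof -
  obtain g :: "nat \<Rightarrow> nat" where g: "\<And>N. extends ((-1) ^ a) N (g N) (g (Suc N))"
    using ex_extending_sequence[of "(-1) ^ a"] by (metis neg_one_even_power neg_one_odd_power)
  have sm: "strict_mono g" using g by (auto simp: extends_def strict_mono_Suc_iff)
  have pos: "g i \<ge> 1" if "i \<ge> 1" for i
    using strict_mono_less[OF sm, of 0 i] that by auto
  have "osum (g ` {k..}) k \<subseteq> RS a" if k: "k \<ge> 1" for k
  proof
    fix x assume "x \<in> osum (g ` {k..}) k"
    then obtain b where b: "x = (\<Sum>i=1..k. b i)" "\<And>i. i \<in> {1..k} \<Longrightarrow> b i \<in> g ` {k..}"
      by (auto simp: osum_def)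
    then have "\<forall>j\<in>{1..k}. \<exists>i\<ge>k. b j = g i" by fastforce
    then obtain i where i: "\<And>j. j \<in> {1..k} \<Longrightarrow> i j \<ge> k \<and> b j = g (i j)" by metis
    \<comment> \<open>A level no index exceeds, so capping at \<open>k + m\<close> changes
      nothing.\<close>
    define m where "m = (\<Sum>j=1..k. i j)"
    have "i j \<le> m" if "j \<in> {1..k}" for j
      unfolding m_def using that by (intro member_le_sum) auto
    then have "x = (\<Sum>j\<in>{1..k}. g (min (i j) (k + m)))"
      unfolding b(1) using i by (intro sum.cong) (auto simp: min_absorb1 trans_le_add2)
    also have "rs_sign \<dots> = (-1) ^ a"
      using truncated_sum_sign[OF g, of "{1..k}" k i m] i k by simp
    finally have "rs_sign x = (-1) ^ a" .
    moreover have "x \<ge> 1"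
    proof -
      have "1 \<le> b 1" using i[of 1] k pos[of "i 1"] by auto
      also have "\<dots> \<le> x" unfolding b(1) using k by (intro member_le_sum) auto
      finally show ?thesis .
    qed
    ultimately show "x \<in> RS a" using RS_iff[OF a] by simp
  qed
  moreover have "infinite (g ` {k..})" for k
    using finite_imageD[of g "{k..}"] strict_mono_imp_inj_on[OF sm] infinite_Ici[of k]
    by (meson inj_on_subset subset_UNIV)
  ultimately show ?thesis using pos by (intro exI[of _ "\<lambda>k. g ` {k..}"]) auto
qed

section \<open>Averages along Folner sequences\<close>

definition ravg :: "nat set \<Rightarrow> (nat \<Rightarrow> real) \<Rightarrow> real" where
  "ravg F f = (\<Sum>n\<in>F. f n) / real (card F)"

lemma ravg_add: "ravg F (\<lambda>n. f n + g n) = ravg F f + ravg F g"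
  by (simp add: ravg_def sum.distrib add_divide_distrib)

lemma ravg_scale: "ravg F (\<lambda>n. c * f n) = c * ravg F f"
  by (simp add: ravg_def sum_distrib_left)

lemma ravg_cong: "(\<And>n. n \<in> F \<Longrightarrow> f n = g n) \<Longrightarrow> ravg F f = ravg F g"
  by (simp add: ravg_def)

lemma ravg_close:
  assumes "\<And>n. n \<in> F \<Longrightarrow> \<bar>f n - g n\<bar> \<le> b n"
  shows "\<bar>ravg F f - ravg F g\<bar> \<le> ravg F b"
proof -
  have "\<bar>(\<Sum>n\<in>F. f n) - (\<Sum>n\<in>F. g n)\<bar> \<le> (\<Sum>n\<in>F. b n)"
    unfolding sum_subtractf[symmetric] using assms by (intro order.trans[OF sum_abs] sum_mono)
  then show ?thesis
    by (simp add: ravg_def divide_right_mono flip: diff_divide_distrib)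
qed

lemma ravg_le_const: "\<lbrakk>\<And>n. n \<in> F \<Longrightarrow> b n \<le> c; c \<ge> 0\<rbrakk> \<Longrightarrow> ravg F b \<le> c"
  using sum_bounded_above[of F b c] by (cases "card F = 0") (auto simp: ravg_def field_simps)

text \<open>Turns the averages over \<open>h\<close> in the recursive seminorms into Folner
  averages. \<open>Suc N\<close> keeps the sets nonempty.\<close>

lemma folner_initial: "folner (\<lambda>N. {1..Suc N})"
proof -
  have "(\<lambda>N. real (card (sym_diff {1..Suc N} ((\<lambda>n. n + t) ` {1..Suc N}))) / real (card {1..Suc N}))
      \<longlonglongrightarrow> 0" for t
  proof (rule real_tendsto_sandwich)
    show "(\<lambda>N::nat. 0::real) \<longlonglongrightarrow> 0" by simp
    show "(\<lambda>N. 2 * real t / real (Suc N)) \<longlonglongrightarrow> 0"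
      by (rule LIMSEQ_Suc[OF lim_const_over_n])
    have "card (sym_diff {1..Suc N} ((\<lambda>n. n + t) ` {1..Suc N})) \<le> 2 * t" for N
    proof -
      have "sym_diff {1..Suc N} ((\<lambda>n. n + t) ` {1..Suc N}) \<subseteq> {1..t} \<union> {Suc N<..Suc N + t}"
        by (auto simp: image_add_atLeastAtMost')
      then have "card (sym_diff {1..Suc N} ((\<lambda>n. n + t) ` {1..Suc N})) \<le> card ({1..t} \<union> {Suc N<..Suc N + t})"
        by (intro card_mono) auto
      also have "\<dots> \<le> 2 * t" using card_Un_le[of "{1..t}" "{Suc N<..Suc N + t}"] by simp
      finally show ?thesis .
    qed
    then have "real (card (sym_diff {1..Suc N} ((\<lambda>n. n + t) ` {1..Suc N}))) \<le> 2 * real t" for N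
      by (metis of_nat_le_iff of_nat_mult of_nat_numeral)
    then show "\<forall>\<^sub>F N in sequentially. real (card (sym_diff {1..Suc N} ((\<lambda>n. n + t) ` {1..Suc N}))) /
        real (card {1..Suc N}) \<le> 2 * real t / real (Suc N)"
      by (intro always_eventually allI) (simp add: divide_right_mono)
  qed (auto intro!: always_eventually)
  then show ?thesis by (simp add: folner_def)
qed

text \<open>For bounded \<open>f\<close> this is almost convergence to \<open>x\<close> in the sense
  of Lorentz. One window length per \<epsilon> suffices, since any long window splits into such
  windows up to a short remainder.\<close>

definition uniform_mean :: "(nat \<Rightarrow> real) \<Rightarrow> real \<Rightarrow> bool" where
  "uniform_mean f x \<longleftrightarrow>
     (\<forall>\<epsilon>>0. \<exists>T>0. \<forall>n. \<bar>(\<Sum>t<T. f (n + t)) - real T * x\<bar> \<le> \<epsilon> * real T)"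

lemma folner_shift:
  assumes "folner \<Phi>" "\<And>n. \<bar>f n\<bar> \<le> C"
  shows "(\<lambda>N. ravg (\<Phi> N) f - ravg (\<Phi> N) (\<lambda>n. f (n + t))) \<longlonglongrightarrow> 0"
proof (cases "t = 0")
  case False
  let ?S = "\<lambda>N. sym_diff (\<Phi> N) ((\<lambda>n. n + t) ` \<Phi> N)"
  have fin: "finite (\<Phi> N)" for N using assms(1) by (simp add: folner_def)
  have lim: "(\<lambda>N. C * (real (card (?S N)) / real (card (\<Phi> N)))) \<longlonglongrightarrow> C * 0"
    using assms(1) False by (intro tendsto_mult_left) (simp add: folner_def)
  have "\<bar>ravg (\<Phi> N) f - ravg (\<Phi> N) (\<lambda>n. f (n + t))\<bar> \<le> C * (real (card (?S N)) / real (card (\<Phi> N)))" for N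
  proof -
    let ?F = "\<Phi> N" and ?G = "(\<lambda>n. n + t) ` \<Phi> N"
    have "(\<Sum>n\<in>?F. f (n + t)) = (\<Sum>n\<in>?G. f n)"
      by (simp add: sum.reindex)
    moreover have "(\<Sum>n\<in>?F. f n) = (\<Sum>n\<in>?F - ?G. f n) + (\<Sum>n\<in>?F \<inter> ?G. f n)"
      using fin sum.Int_Diff[of ?F f ?G] by (simp add: add.commute)
    moreover have "(\<Sum>n\<in>?G. f n) = (\<Sum>n\<in>?G - ?F. f n) + (\<Sum>n\<in>?F \<inter> ?G. f n)"
      using fin sum.Int_Diff[of ?G f ?F] by (simp add: Int_commute add.commute)
    ultimately have "(\<Sum>n\<in>?F. f n) - (\<Sum>n\<in>?F. f (n + t)) = (\<Sum>n\<in>?F - ?G. f n) - (\<Sum>n\<in>?G - ?F. f n)"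
      by simp
    moreover have "\<bar>\<Sum>n\<in>?F - ?G. f n\<bar> \<le> real (card (?F - ?G)) * C"
      by (rule order.trans[OF sum_abs sum_bounded_above]) (rule assms)
    moreover have "\<bar>\<Sum>n\<in>?G - ?F. f n\<bar> \<le> real (card (?G - ?F)) * C"
      by (rule order.trans[OF sum_abs sum_bounded_above]) (rule assms)
    moreover have "card (?S N) = card (?F - ?G) + card (?G - ?F)"
      using fin by (intro card_Un_disjoint) auto
    ultimately have "\<bar>(\<Sum>n\<in>?F. f n) - (\<Sum>n\<in>?F. f (n + t))\<bar> \<le> C * real (card (?S N))"
      by (simp add: algebra_simps)
    then show ?thesis
      by (simp add: ravg_def divide_right_mono flip: diff_divide_distrib)
  qed
  then have "\<forall>\<^sub>F N in sequentially. norm (ravg (\<Phi> N) f - ravg (\<Phi> N) (\<lambda>n. f (n + t)))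
      \<le> C * (real (card (?S N)) / real (card (\<Phi> N)))"
    by (intro always_eventually allI) (simp only: real_norm_def)
  then show ?thesis
    by (rule Lim_null_comparison) (use lim in simp)
qed simp

text \<open>Averaging \<open>folner_shift\<close> over \<open>t < T\<close> replaces
  \<open>f\<close> by its window means, which are uniformly close to \<open>x\<close>.\<close>

lemma folner_ravg_tendsto:
  assumes \<Phi>: "folner \<Phi>" and bd: "\<And>n. \<bar>f n\<bar> \<le> C" and um: "uniform_mean f x"
  shows "(\<lambda>N. ravg (\<Phi> N) f) \<longlonglongrightarrow> x"
proof (rule LIMSEQ_I)
  fix \<epsilon> :: real assume "\<epsilon> > 0"
  then have e2: "\<epsilon> / 2 > 0" by simp
  then obtain T where T: "T > 0"
    "\<And>n. \<bar>(\<Sum>t<T. f (n + t)) - real T * x\<bar> \<le> \<epsilon> / 2 * real T"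
    using um unfolding uniform_mean_def by blast
  define D where "D N = (\<Sum>t<T. ravg (\<Phi> N) f - ravg (\<Phi> N) (\<lambda>n. f (n + t)))" for N
  have "D \<longlonglongrightarrow> (\<Sum>t<T. 0)"
    unfolding D_def by (intro tendsto_sum folner_shift[OF \<Phi> bd])
  then obtain N0 where N0: "\<And>N. N \<ge> N0 \<Longrightarrow> \<bar>D N\<bar> < \<epsilon> / 2 * real T"
    using LIMSEQ_D[of D 0 "\<epsilon> / 2 * real T"] e2 T(1) by fastforce
  have "norm (ravg (\<Phi> N) f - x) < \<epsilon>" if "N \<ge> N0" for N
  proof -
    have "card (\<Phi> N) > 0" using \<Phi> by (simp add: folner_def card_gt_0_iff)
    then have c: "ravg (\<Phi> N) (\<lambda>n. c) = c" for c by (simp add: ravg_def)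
    have "D N = real T * ravg (\<Phi> N) f - ravg (\<Phi> N) (\<lambda>n. \<Sum>t<T. f (n + t))"
      unfolding D_def ravg_def sum_subtractf
      by (subst sum.swap) (simp add: sum_divide_distrib)
    moreover have "\<bar>ravg (\<Phi> N) (\<lambda>n. \<Sum>t<T. f (n + t)) - ravg (\<Phi> N) (\<lambda>n. real T * x)\<bar>
        \<le> ravg (\<Phi> N) (\<lambda>n. \<epsilon> / 2 * real T)"
      by (rule ravg_close) (rule T)
    ultimately have "\<bar>real T * (ravg (\<Phi> N) f - x)\<bar> < \<epsilon> * real T"
      using N0[OF that] unfolding c right_diff_distrib by argo
    then show ?thesis using T(1) by (simp add: abs_mult)
  qed
  then show "\<exists>N0. \<forall>N\<ge>N0. norm (ravg (\<Phi> N) f - x) < \<epsilon>" by blast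
qed

lemma sum_blocks: "(\<Sum>n<T * U. f n) = (\<Sum>y<U. \<Sum>x<T. f (x + T * y))" for f :: "nat \<Rightarrow> 'a :: comm_monoid_add"
proof -
  have "sum f {y * T..<y * T + T} = (\<Sum>x<T. f (x + T * y))" for y
    using sum.shift_bounds_nat_ivl[of f 0 "y * T" T]
    by (simp add: atLeast0LessThan mult.commute add.commute)
  then show ?thesis using sum.nat_group[of f T U] by (simp add: mult.commute)
qed

text \<open>Aligned dyadic blocks consist of the numbers with a common high binary part. A window of
  length \<open>T * K\<close> differs from \<open>K\<close> aligned blocks by two pieces shorter
  than \<open>T\<close>, which are negligible for large \<open>K\<close>.\<close>

lemma uniform_mean_0_aligned:
  assumes bd: "\<And>n. \<bar>f n\<bar> \<le> C"
    and al: "\<And>\<epsilon>. \<epsilon> > 0 \<Longrightarrow> \<exists>T>0. \<forall>q. \<bar>\<Sum>t<T. f (t + T * q)\<bar> \<le> \<epsilon> * real T"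
  shows "uniform_mean f 0"
  unfolding uniform_mean_def
proof (intro allI impI)
  fix \<epsilon> :: real assume "\<epsilon> > 0"
  then have e2: "\<epsilon> / 2 > 0" by simp
  then obtain T where T: "T > 0" "\<And>q. \<bar>\<Sum>t<T. f (t + T * q)\<bar> \<le> \<epsilon> / 2 * real T"
    using al by blast
  obtain K :: nat where K: "4 * C / \<epsilon> < real K" using reals_Archimedean2 by blast
  have C: "C \<ge> 0" using bd[of 0] by simp
  have K0: "K > 0" using K C \<open>\<epsilon> > 0\<close> by (cases K) (auto simp: field_simps)
  have KC: "2 * C \<le> \<epsilon> / 2 * real K" using K \<open>\<epsilon> > 0\<close> by (simp add: field_simps)
  have "\<bar>\<Sum>t<T * K. f (n + t)\<bar> \<le> \<epsilon> * real (T * K)" for n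
  proof -
    define q r where "q = n div T" and "r = n mod T"
    have n: "n = T * q + r" and r: "r < T" using T(1) by (simp_all add: q_def r_def)
    have part: "\<bar>\<Sum>t<r. f (m + t)\<bar> \<le> real T * C" for m
    proof -
      have "\<bar>\<Sum>t<r. f (m + t)\<bar> \<le> real (card {..<r}) * C"
        by (rule order.trans[OF sum_abs sum_bounded_above]) (rule bd)
      also have "\<dots> \<le> real T * C" using r C by (intro mult_right_mono) auto
      finally show ?thesis .
    qed
    have main: "\<bar>\<Sum>t<T * K. f (T * q + t)\<bar> \<le> \<epsilon> / 2 * real (T * K)"
    proof -
      have "(\<Sum>t<T * K. f (T * q + t)) = (\<Sum>y<K. \<Sum>t<T. f (t + T * (q + y)))"
        unfolding sum_blocks by (simp add: algebra_simps)
      also have "\<bar>\<dots>\<bar> \<le> real (card {..<K}) * (\<epsilon> / 2 * real T)"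
        by (rule order.trans[OF sum_abs sum_bounded_above]) (rule T(2))
      finally show ?thesis by (simp add: mult_ac)
    qed
    have *: "(\<Sum>t<a + b. f (m + t)) = (\<Sum>t<a. f (m + t)) + (\<Sum>t<b. f (m + a + t))" for a b m
      by (induction b) (auto simp: algebra_simps)
    have "(\<Sum>t<r. f (T * q + t)) + (\<Sum>t<T * K. f (n + t)) =
        (\<Sum>t<T * K. f (T * q + t)) + (\<Sum>t<r. f (T * q + T * K + t))"
      using *[where a = r and b = "T * K" and m = "T * q"] *[where a = "T * K" and b = r and m = "T * q"]
      by (simp add: n add.commute)
    then have "\<bar>\<Sum>t<T * K. f (n + t)\<bar> \<le> \<epsilon> / 2 * real (T * K) + real T * (2 * C)"
      using main part[of "T * q"] part[of "T * q + T * K"] by linarith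
    also have "real T * (2 * C) \<le> real T * (\<epsilon> / 2 * real K)"
      by (rule mult_left_mono[OF KC]) simp
    finally show ?thesis by (simp add: algebra_simps)
  qed
  then show "\<exists>T>0. \<forall>n. \<bar>(\<Sum>t<T. f (n + t)) - real T * 0\<bar> \<le> \<epsilon> * real T"
    using T(1) K0 by (intro exI[of _ "T * K"]) auto
qed

section \<open>Periodic functions and limits by approximation\<close>

definition periodic :: "nat \<Rightarrow> (nat \<Rightarrow> 'a) \<Rightarrow> bool" where
  "periodic q p \<longleftrightarrow> (\<forall>n. p (n + q) = p n)"

lemma periodicD: "periodic q p \<Longrightarrow> p (n + q) = p n"
  by (simp add: periodic_def)

lemma periodic_mult: "periodic q p \<Longrightarrow> p (n + q * y) = p n"
proof (induction y)
  case (Suc y)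
  then show ?case using periodicD[OF Suc.prems, of "n + q * y"] by (simp add: add_ac)
qed simp

lemma periodic_mod: "periodic q p \<Longrightarrow> p (n mod q) = p n"
  using periodic_mult[of q p "n mod q" "n div q"] by simp

lemma periodic_shift: "periodic q p \<Longrightarrow> periodic q (\<lambda>n. p (n + h))"
  unfolding periodic_def by (metis add.assoc add.commute)

lemma periodic_bounded:
  fixes p :: "nat \<Rightarrow> real"
  assumes "periodic q p" "q > 0"
  obtains C where "\<And>n. \<bar>p n\<bar> \<le> C"
proof
  fix n
  have "n mod q \<in> {..<q}" using assms by simp
  then have "\<bar>p (n mod q)\<bar> \<le> (\<Sum>i<q. \<bar>p i\<bar>)" by (intro member_le_sum) auto
  then show "\<bar>p n\<bar> \<le> (\<Sum>i<q. \<bar>p i\<bar>)" using periodic_mod[OF assms(1)] by simp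
qed

lemma sum_periodic:
  fixes p :: "nat \<Rightarrow> 'a :: cancel_comm_monoid_add"
  assumes "periodic q p"
  shows "(\<Sum>t<q. p (n + t)) = (\<Sum>t<q. p t)"
proof (induction n)
  case (Suc n)
  have "p n + (\<Sum>t<q. p (Suc n + t)) = (\<Sum>t<Suc q. p (n + t))"
    by (subst sum.lessThan_Suc_shift) simp
  also have "\<dots> = p n + (\<Sum>t<q. p (n + t))"
    using periodicD[OF assms, of n] by (simp add: add.commute)
  finally show ?case using Suc by simp
qed simp

lemma uniform_mean_periodic:
  assumes "periodic q p" "q > 0"
  shows "uniform_mean p ((\<Sum>n<q. p n) / real q)"
  unfolding uniform_mean_def
proof (intro allI impI exI[of _ q] conjI assms(2))
  fix \<epsilon> :: real and n assume "\<epsilon> > 0"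
  then show "\<bar>(\<Sum>t<q. p (n + t)) - real q * ((\<Sum>t<q. p t) / real q)\<bar> \<le> \<epsilon> * real q"
    using assms sum_periodic[OF assms(1), of n] by simp
qed

lemma folner_ravg_periodic:
  assumes "folner \<Phi>" "periodic q p" "q > 0"
  shows "(\<lambda>N. ravg (\<Phi> N) p) \<longlonglongrightarrow> (\<Sum>n<q. p n) / real q"
  using periodic_bounded[OF assms(2,3)] folner_ravg_tendsto[OF assms(1) _ uniform_mean_periodic[OF assms(2,3)]]
  by metis

lemma initial_ravg_tendsto:
  assumes "\<And>n. \<bar>f n\<bar> \<le> C" "uniform_mean f x"
  shows "(\<lambda>H. ravg {1..H} f) \<longlonglongrightarrow> x"
  using folner_ravg_tendsto[OF folner_initial assms] by (rule LIMSEQ_imp_Suc)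

text \<open>The limit is not known beforehand and \<open>v\<close> may depend on \<epsilon>.
  Eventually \<open>a\<close> stays within 3\<epsilon>/8 of \<open>v\<close>, so \<open>a\<close> is
  Cauchy.\<close>

lemma approximable_convergent:
  fixes a :: "nat \<Rightarrow> real"
  assumes "\<And>\<epsilon>. \<epsilon> > 0 \<Longrightarrow> \<exists>g b v \<beta>. \<beta> \<le> \<epsilon> \<and> (\<forall>N. \<bar>a N - g N\<bar> \<le> b N) \<and> g \<longlonglongrightarrow> v \<and> b \<longlonglongrightarrow> \<beta>"
  shows "convergent a"
proof (rule Cauchy_convergent, rule metric_CauchyI)
  fix \<epsilon> :: real assume "\<epsilon> > 0"
  then have e: "\<epsilon> / 8 > 0" by simp
  obtain g b v \<beta> where g: "\<beta> \<le> \<epsilon> / 8" "\<And>N. \<bar>a N - g N\<bar> \<le> b N" "g \<longlonglongrightarrow> v" "b \<longlonglongrightarrow> \<beta>"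
    using assms[OF e] by blast
  obtain N1 where N1: "\<And>N. N \<ge> N1 \<Longrightarrow> \<bar>g N - v\<bar> < \<epsilon> / 8"
    using LIMSEQ_D[OF g(3) e] by auto
  obtain N2 where N2: "\<And>N. N \<ge> N2 \<Longrightarrow> \<bar>b N - \<beta>\<bar> < \<epsilon> / 8"
    using LIMSEQ_D[OF g(4) e] by auto
  have "\<bar>a m - v\<bar> < \<epsilon> / 2" if "m \<ge> max N1 N2" for m
  proof -
    have "\<bar>g m - v\<bar> < \<epsilon> / 8" "\<bar>b m - \<beta>\<bar> < \<epsilon> / 8" using N1[of m] N2[of m] that by auto
    then show ?thesis using g(2)[of m] g(1) \<open>\<epsilon> > 0\<close> by linarith
  qed
  then have "dist (a m) (a n) < \<epsilon>" if "m \<ge> max N1 N2" "n \<ge> max N1 N2" for m n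
    using that unfolding dist_real_def by (smt (verit) field_sum_of_halves)
  then show "\<exists>M. \<forall>m\<ge>M. \<forall>n\<ge>M. dist (a m) (a n) < \<epsilon>" by blast
qed

lemma close_limits:
  fixes a :: "nat \<Rightarrow> real"
  assumes "a \<longlonglongrightarrow> x" "\<And>N. \<bar>a N - g N\<bar> \<le> b N" "g \<longlonglongrightarrow> v" "b \<longlonglongrightarrow> \<beta>"
  shows "\<bar>x - v\<bar> \<le> \<beta>"
  using assms(2) by (intro LIMSEQ_le[OF tendsto_rabs[OF tendsto_diff[OF assms(1,3)]] assms(4)]) auto

text \<open>Parallelogram law: the plain and the alternating sum over a dyadic block of length
  \<open>2\<^sup>L\<close> determine those of length \<open>2\<^sup>L\<^sup>+\<^sup>1\<close> as their sum and difference.\<close>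
lemma rs_sign_block_sums:
  "(\<Sum>t<2^L. rs_sign (t + 2^L * q))\<^sup>2 + (\<Sum>t<2^L. (-1)^t * rs_sign (t + 2^L * q))\<^sup>2 = 2 * 2^L"
proof (induction L)
  case 0
  show ?case using rs_sign_cases[of q] by auto
next
  case (Suc L)
  have split: "(\<Sum>t<2^Suc L. f t) = (\<Sum>t<2^L. f (2 * t) + f (Suc (2 * t)))" for f :: "nat \<Rightarrow> real"
    unfolding power_Suc sum_blocks by (simp add: numeral_2_eq_2)
  let ?P = "\<Sum>t<2^L. rs_sign (t + 2^L * q)" and ?R = "\<Sum>t<2^L. (-1)^t * rs_sign (t + 2^L * q)"
  have e: "rs_sign (2 * t + 2 ^ Suc L * q) = rs_sign (t + 2^L * q)" for t
    using rs_sign_double[of "t + 2^L * q"] by (simp add: algebra_simps)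
  have o: "rs_sign (Suc (2 * t) + 2 ^ Suc L * q) = rs_sign (t + 2^L * q) * (-1)^t * (-1)^(2^L*q)" for t
    using rs_sign_double_Suc[of "t + 2^L * q"] by (simp add: algebra_simps power_add)
  have P: "(\<Sum>t<2^Suc L. rs_sign (t + 2^Suc L * q)) = ?P + (-1)^(2^L*q) * ?R"
    unfolding split e o by (simp add: sum.distrib sum_distrib_left mult_ac)
  have R: "(\<Sum>t<2^Suc L. (-1)^t * rs_sign (t + 2^Suc L * q)) = ?P - (-1)^(2^L*q) * ?R"
    unfolding split e o by (simp add: sum_subtractf sum_distrib_left mult_ac)
  have "((-1::real)^(2^L*q))\<^sup>2 = 1" by (simp flip: power_mult)
  then show ?case unfolding P R using Suc
    by (simp add: power2_sum power2_diff power_mult_distrib)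
qed

text \<open>The flag \<open>c\<close> selects the alternating or the plain sum; each square is
  bounded by the total in \<open>rs_sign_block_sums\<close>. These are the sums that
  \<open>rs_sign_split\<close> leaves once the low digits are fixed.\<close>

lemma rs_sign_twisted_block_bound:
  "\<bar>\<Sum>m<2^L. rs_sign (m + 2^L * q) * (if c \<and> odd (m + 2^L * q) then -1 else 1)\<bar> \<le> sqrt (2 * 2^L)"
proof -
  let ?P = "\<Sum>t<2^L. rs_sign (t + 2^L * q)" and ?R = "\<Sum>t<2^L. (-1)^t * rs_sign (t + 2^L * q)"
  have "\<bar>x\<bar> \<le> sqrt c" if "x\<^sup>2 + y\<^sup>2 = c" for x y c :: real
  proof (rule real_le_rsqrt)
    show "\<bar>x\<bar>\<^sup>2 \<le> c" using that zero_le_power2[of y] unfolding power2_abs by linarith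
  qed
  from this[OF rs_sign_block_sums] this[OF trans[OF add.commute rs_sign_block_sums]]
  have "\<bar>?P\<bar> \<le> sqrt (2 * 2^L)" "\<bar>?R\<bar> \<le> sqrt (2 * 2^L)" .
  moreover have "(\<Sum>m<2^L. rs_sign (m + 2^L * q) * (if c \<and> odd (m + 2^L * q) then -1 else 1)) =
      (if c then (-1) ^ (2^L * q) * ?R else ?P)"
    by (auto simp: sum_distrib_left minus_one_power_iff intro!: sum.cong)
  ultimately show ?thesis by (simp add: abs_mult)
qed

text \<open>Writing the argument as \<open>t + 2 ^ M * m\<close>, the factor \<open>v\<close> sees
  only \<open>t\<close>. For fixed \<open>t\<close> the sum over a dyadic block of \<open>m\<close>
  is a twisted block sum with square-root cancellation.\<close>

lemma uniform_mean_periodic_mult_rs_sign: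
  assumes per: "periodic (2^M) v" and bd: "\<And>n. \<bar>v n\<bar> \<le> C"
  shows "uniform_mean (\<lambda>n. v n * rs_sign n) 0"
proof (rule uniform_mean_0_aligned)
  show "\<bar>v n * rs_sign n\<bar> \<le> C" for n using bd[of n] by (simp add: abs_mult)
  fix \<epsilon> :: real assume "\<epsilon> > 0"
  have C: "C \<ge> 0" using bd[of 0] by simp
  obtain L :: nat where L: "2 * C\<^sup>2 / \<epsilon>\<^sup>2 < 2 ^ L"
    using real_arch_pow[of 2] by auto
  have L': "C * sqrt (2 * 2^L) \<le> \<epsilon> * 2^L"
  proof -
    have "2 * C\<^sup>2 * 2^L \<le> \<epsilon>\<^sup>2 * 2^L * 2^L"
      using L \<open>\<epsilon> > 0\<close> by (intro mult_right_mono) (auto simp: field_simps)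
    then have "(C * sqrt (2 * 2^L))\<^sup>2 \<le> (\<epsilon> * 2^L)\<^sup>2"
      by (simp add: power_mult_distrib) (simp add: power2_eq_square mult_ac)
    then show ?thesis by (rule power2_le_imp_le) (use \<open>\<epsilon> > 0\<close> in simp)
  qed
  have "\<bar>\<Sum>t<2^M * 2^L. v (t + 2^M * 2^L * q) * rs_sign (t + 2^M * 2^L * q)\<bar> \<le> \<epsilon> * real (2^M * 2^L)" for q
  proof -
    have "(\<Sum>t<2^M * 2^L. v (t + 2^M * 2^L * q) * rs_sign (t + 2^M * 2^L * q)) =
       (\<Sum>m<2^L. \<Sum>t<2^M. v (t + 2^M * (m + 2^L * q)) * rs_sign (t + 2^M * (m + 2^L * q)))"
      unfolding sum_blocks by (simp add: algebra_simps)
    also have "\<dots> = (\<Sum>t<2^M. v t * rs_sign t * (\<Sum>m<2^L. rs_sign (m + 2^L * q) *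
        (if 2^M \<le> 2 * t \<and> odd (m + 2^L * q) then -1 else 1)))"
      by (subst sum.swap) (simp add: periodic_mult[OF per] rs_sign_split sum_distrib_left mult.assoc)
    also have "\<bar>\<dots>\<bar> \<le> real (card {..<(2::nat)^M}) * (C * sqrt (2 * 2^L))"
    proof (rule order.trans[OF sum_abs sum_bounded_above])
      fix t :: nat
      show "\<bar>v t * rs_sign t * (\<Sum>m<2^L. rs_sign (m + 2^L * q) *
        (if 2^M \<le> 2 * t \<and> odd (m + 2^L * q) then -1 else 1))\<bar> \<le> C * sqrt (2 * 2^L)"
        unfolding abs_mult abs_rs_sign mult_1_right
        by (intro mult_mono bd rs_sign_twisted_block_bound C) simp
    qed
    also have "\<dots> \<le> 2^M * (\<epsilon> * 2^L)" using L' by simp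
    finally show ?thesis by (simp add: mult_ac)
  qed
  then show "\<exists>T>0. \<forall>q. \<bar>\<Sum>t<T. v (t + T * q) * rs_sign (t + T * q)\<bar> \<le> \<epsilon> * real T"
    by (intro exI[of _ "2^M * 2^L"]) simp
qed

section \<open>Limit-periodic functions\<close>

definition mdiff :: "nat \<Rightarrow> (nat \<Rightarrow> real) \<Rightarrow> nat \<Rightarrow> real" where
  "mdiff h f n = f n * f (n + h)"

text \<open>\<open>has_U_power \<Phi> k f x\<close>: the \<open>2\<^sup>k\<close>-th power of the \<open>U\<^sup>k(\<Phi>)\<close>-seminorm of the real
  function \<open>f\<close> is \<open>x\<close>; working with the powers avoids the roots in the recursion.\<close>
fun has_U_power :: "(nat \<Rightarrow> nat set) \<Rightarrow> nat \<Rightarrow> (nat \<Rightarrow> real) \<Rightarrow> real \<Rightarrow> bool" where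
  "has_U_power \<Phi> 0 f x \<longleftrightarrow> (\<lambda>N. ravg (\<Phi> N) f) \<longlonglongrightarrow> x"
| "has_U_power \<Phi> (Suc k) f x \<longleftrightarrow> 0 \<le> x \<and>
     (\<exists>w. (\<forall>h\<ge>1. has_U_power \<Phi> k (mdiff h f) (w h)) \<and> (\<lambda>H. ravg {1..H} w) \<longlonglongrightarrow> x)"

lemma avg_of_real: "avg F (\<lambda>n. of_real (f n)) = of_real (ravg F f)"
  by (simp add: avg_def ravg_def)

lemma has_U_power_imp_has_U_norm:
  "has_U_power \<Phi> k f x \<Longrightarrow>
     has_U_norm \<Phi> k (\<lambda>n. of_real (f n)) (of_real (if k = 0 then x else root (2 ^ k) x))"
proof (induction k arbitrary: f x)
  case 0
  then show ?case by (simp add: avg_of_real tendsto_of_real)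
next
  case (Suc k)
  then obtain w where x: "x \<ge> 0" and w: "\<And>h. h \<ge> 1 \<Longrightarrow> has_U_power \<Phi> k (mdiff h f) (w h)"
    and lim: "(\<lambda>H. ravg {1..H} w) \<longlonglongrightarrow> x" by auto
  define v where "v h = (if k = 0 then w h else root (2 ^ k) (w h))" for h
  have v: "v h ^ 2 ^ k = w h" if "h \<ge> 1" for h
    using w[OF that] by (cases k) (auto simp: v_def real_root_pow_pos2)
  have "mult_diff h (\<lambda>n. of_real (f n)) = (\<lambda>n. of_real (mdiff h f n))" for h
    by (simp add: mult_diff_def mdiff_def fun_eq_iff)
  then have "has_U_norm \<Phi> k (mult_diff h (\<lambda>n. of_real (f n))) (of_real (v h))" if "h \<ge> 1" for h
    using Suc.IH[OF w[OF that]] by (simp add: v_def)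
  moreover have "avg {1..H} (\<lambda>h. complex_of_real (v h) ^ 2 ^ k) = of_real (ravg {1..H} w)" for H
    unfolding avg_of_real[symmetric] unfolding avg_def using v
    by (intro arg_cong2[where f = "(/)"] sum.cong) (auto simp flip: of_real_power)
  then have "(\<lambda>H. avg {1..H} (\<lambda>h. complex_of_real (v h) ^ 2 ^ k)) \<longlonglongrightarrow>
      of_real (root (2 ^ Suc k) x) ^ 2 ^ Suc k"
    using tendsto_of_real[OF lim] x
    by (simp add: real_root_pow_pos2 del: power_Suc flip: of_real_power)
  ultimately show ?case using x
    by (auto simp del: power_Suc intro!: exI[of _ "\<lambda>h. complex_of_real (v h)"])
qed

lemma has_U_power_scale:
  "has_U_power \<Phi> k f x \<Longrightarrow> has_U_power \<Phi> k (\<lambda>n. c * f n) (c ^ 2 ^ k * x)"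
proof (induction k arbitrary: f x c)
  case 0
  then show ?case by (simp add: ravg_scale tendsto_mult_left)
next
  case (Suc k)
  then obtain w where x: "x \<ge> 0" and w: "\<And>h. h \<ge> 1 \<Longrightarrow> has_U_power \<Phi> k (mdiff h f) (w h)"
    and lim: "(\<lambda>H. ravg {1..H} w) \<longlonglongrightarrow> x" by auto
  have "mdiff h (\<lambda>n. c * f n) = (\<lambda>n. c\<^sup>2 * mdiff h f n)" for h
    by (simp add: mdiff_def fun_eq_iff power2_eq_square)
  then have "has_U_power \<Phi> k (mdiff h (\<lambda>n. c * f n)) (c ^ 2 ^ Suc k * w h)" if "h \<ge> 1" for h
    using Suc.IH[OF w[OF that], of "c\<^sup>2"] by (simp add: power_mult)
  moreover have "(\<lambda>H. ravg {1..H} (\<lambda>h. c ^ 2 ^ Suc k * w h)) \<longlonglongrightarrow> c ^ 2 ^ Suc k * x"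
    unfolding ravg_scale by (intro tendsto_mult_left lim)
  moreover have "c ^ 2 ^ Suc k * x \<ge> 0" using x by (intro mult_nonneg_nonneg) (auto simp: power_mult)
  ultimately show ?case by (auto simp del: power_Suc intro!: exI[of _ "\<lambda>h. c ^ 2 ^ Suc k * w h"])
qed

text \<open>Lets the value at 0 be changed: the averages and the shifts by \<open>h\<close> only
  reach positive arguments.\<close>

lemma has_U_norm_cong:
  assumes "has_U_norm \<Phi> k \<phi> x" "\<And>N. \<Phi> N \<subseteq> {1..}" "\<And>n. n \<ge> 1 \<Longrightarrow> \<phi> n = \<psi> n"
  shows "has_U_norm \<Phi> k \<psi> x"
  using assms(1,3)
proof (induction k arbitrary: \<phi> \<psi> x)
  case 0
  have "avg (\<Phi> N) \<phi> = avg (\<Phi> N) \<psi>" for N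
    unfolding avg_def using 0(2) assms(2)[of N] by (intro arg_cong2[where f = "(/)"] sum.cong) auto
  then show ?case using 0 by simp
next
  case (Suc k)
  have "has_U_norm \<Phi> k (mult_diff h \<psi>) y" if "has_U_norm \<Phi> k (mult_diff h \<phi>) y" for h y
    by (rule Suc.IH[OF that]) (simp add: mult_diff_def Suc.prems(2))
  then show ?case using Suc.prems(1) by auto
qed

text \<open>For a \<open>q\<close>-periodic \<open>p\<close> this is its mean when
  \<open>k = 0\<close> and otherwise the \<open>2\<^sup>k\<close>-th power of its Gowers norm on the
  integers modulo \<open>q\<close>; periodicity lets the sums \<open>n + h\<close> stay
  unreduced.\<close>

fun cyclic_U_power :: "nat \<Rightarrow> nat \<Rightarrow> (nat \<Rightarrow> real) \<Rightarrow> real" where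
  "cyclic_U_power q 0 p = (\<Sum>n<q. p n) / real q"
| "cyclic_U_power q (Suc k) p = (\<Sum>h<q. cyclic_U_power q k (mdiff h p)) / real q"

lemma abs_mdiff_le_1: "(\<And>n. \<bar>p n\<bar> \<le> 1) \<Longrightarrow> \<bar>mdiff h p n\<bar> \<le> 1"
  by (simp add: mdiff_def abs_mult mult_le_one)

lemma abs_cyclic_U_power_le_1:
  assumes "\<And>n. \<bar>p n\<bar> \<le> 1"
  shows "\<bar>cyclic_U_power q k p\<bar> \<le> 1"
  using assms
proof (induction k arbitrary: p)
  case 0
  have "\<bar>\<Sum>n<q. p n\<bar> \<le> real (card {..<q}) * 1"
    by (rule order.trans[OF sum_abs sum_bounded_above]) (rule 0)
  then show ?case by (cases "q = 0") (simp_all add: divide_le_eq)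
next
  case (Suc k)
  have "\<bar>\<Sum>h<q. cyclic_U_power q k (mdiff h p)\<bar> \<le> real (card {..<q}) * 1"
    by (rule order.trans[OF sum_abs sum_bounded_above]) (intro Suc.IH abs_mdiff_le_1 Suc.prems)
  then show ?case by (cases "q = 0") (simp_all add: divide_le_eq)
qed

lemma periodic_mdiff: "periodic q p \<Longrightarrow> periodic q (mdiff h p)"
  using periodic_shift[of q p h] by (simp add: periodic_def mdiff_def)

lemma periodic_cyclic_U_power_mdiff:
  assumes "periodic q p"
  shows "periodic q (\<lambda>h. cyclic_U_power q k (mdiff h p))"
proof -
  have "mdiff (h + q) p = mdiff h p" for h
    using periodicD[OF assms] by (simp add: mdiff_def fun_eq_iff flip: add.assoc)
  then show ?thesis by (simp add: periodic_def)
qed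

text \<open>The first power is the square of the mean, and higher ones are averages of lower ones.
  This supplies the nonnegativity demanded by \<open>has_U_power\<close>.\<close>

lemma cyclic_U_power_nonneg:
  assumes "periodic q p"
  shows "cyclic_U_power q (Suc k) p \<ge> 0"
  using assms
proof (induction k arbitrary: p)
  case 0
  have "(\<Sum>h<q. \<Sum>n<q. p n * p (n + h)) = (\<Sum>n<q. p n * (\<Sum>h<q. p (n + h)))"
    by (subst sum.swap) (simp add: sum_distrib_left)
  also have "\<dots> = (\<Sum>n<q. p n) * (\<Sum>n<q. p n)"
    by (simp add: sum_periodic[OF 0] sum_distrib_right)
  finally show ?case by (simp add: mdiff_def flip: sum_divide_distrib)
next
  case (Suc k)
  then show ?case
    unfolding cyclic_U_power.simps(2)[of q "Suc k"]
    by (intro divide_nonneg_nonneg sum_nonneg Suc.IH periodic_mdiff) auto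
qed

text \<open>The error has a periodic majorant of small mean, not a small uniform norm: this controls
  error averages along every Folner sequence and tolerates a sparse set of large errors.\<close>

definition approximant :: "(nat \<Rightarrow> real) \<Rightarrow> nat \<Rightarrow> (nat \<Rightarrow> real) \<Rightarrow> real \<Rightarrow> bool" where
  "approximant f q p \<epsilon> \<longleftrightarrow> q > 0 \<and> periodic q p \<and> (\<forall>n. \<bar>p n\<bar> \<le> 1) \<and>
     (\<exists>b. periodic q b \<and> (\<forall>n. \<bar>f n - p n\<bar> \<le> b n) \<and> (\<Sum>n<q. b n) \<le> \<epsilon> * real q)"

definition limit_periodic :: "(nat \<Rightarrow> real) \<Rightarrow> bool" where
  "limit_periodic f \<longleftrightarrow> (\<forall>n. \<bar>f n\<bar> \<le> 1) \<and> (\<forall>\<epsilon>>0. \<exists>q p. approximant f q p \<epsilon>)"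

lemma approximant_nonneg:
  assumes "approximant f q p \<epsilon>"
  shows "\<epsilon> \<ge> 0"
proof -
  obtain b where b: "\<And>n. \<bar>f n - p n\<bar> \<le> b n" "(\<Sum>n<q. b n) \<le> \<epsilon> * real q" and q: "q > 0"
    using assms by (auto simp: approximant_def)
  have "0 \<le> (\<Sum>n<q. b n)" by (intro sum_nonneg order.trans[OF abs_ge_zero b(1)])
  then have "0 \<le> \<epsilon> * real q" using b(2) by simp
  then show ?thesis using q by (simp add: zero_le_mult_iff)
qed

text \<open>In the product rule the errors at \<open>n\<close> and \<open>n + h\<close> add, and
  both majorants have the same sum over a period; hence the factor 2 at each differencing.\<close>

lemma approximant_mdiff:
  assumes "approximant f q p \<epsilon>" and f: "\<And>n. \<bar>f n\<bar> \<le> 1"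
  shows "approximant (mdiff h f) q (mdiff h p) (2 * \<epsilon>)"
proof -
  obtain b where q: "q > 0" "periodic q p" "\<And>n. \<bar>p n\<bar> \<le> 1"
    and b: "periodic q b" "\<And>n. \<bar>f n - p n\<bar> \<le> b n" "(\<Sum>n<q. b n) \<le> \<epsilon> * real q"
    using assms(1) by (auto simp: approximant_def)
  have "\<bar>mdiff h f n - mdiff h p n\<bar> \<le> b n + b (n + h)" for n
  proof -
    have "mdiff h f n - mdiff h p n = (f n - p n) * f (n + h) + p n * (f (n + h) - p (n + h))"
      by (simp add: mdiff_def algebra_simps)
    also have "\<bar>\<dots>\<bar> \<le> \<bar>f n - p n\<bar> * \<bar>f (n + h)\<bar> + \<bar>p n\<bar> * \<bar>f (n + h) - p (n + h)\<bar>"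
      unfolding abs_mult[symmetric] by (rule abs_triangle_ineq)
    also have "\<dots> \<le> b n * 1 + 1 * b (n + h)"
      using order.trans[OF abs_ge_zero b(2)] by (intro add_mono mult_mono b(2) f q(3)) auto
    finally show ?thesis by simp
  qed
  moreover have "periodic q (\<lambda>n. b n + b (n + h))"
    using b(1) periodic_shift[OF b(1), of h] by (simp add: periodic_def)
  moreover have "(\<Sum>n<q. b n + b (n + h)) \<le> 2 * \<epsilon> * real q"
    using sum_periodic[OF b(1), of h] b(3) by (simp add: sum.distrib add.commute)
  ultimately show ?thesis
    using q periodic_mdiff[OF q(2), of h] abs_mdiff_le_1[of p h, OF q(3)] unfolding approximant_def by blast
qed

lemma limit_periodic_mdiff:
  assumes "limit_periodic f"
  shows "limit_periodic (mdiff h f)"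
  unfolding limit_periodic_def
proof (intro conjI allI impI)
  show "\<bar>mdiff h f n\<bar> \<le> 1" for n
    using assms by (intro abs_mdiff_le_1) (simp add: limit_periodic_def)
  fix \<epsilon> :: real assume "\<epsilon> > 0"
  then have "\<epsilon> / 2 > 0" by simp
  then obtain q p where "approximant f q p (\<epsilon> / 2)" using assms unfolding limit_periodic_def by blast
  then have "approximant (mdiff h f) q (mdiff h p) (2 * (\<epsilon> / 2))"
    using assms by (intro approximant_mdiff) (auto simp: limit_periodic_def)
  then show "\<exists>q p. approximant (mdiff h f) q p \<epsilon>" by auto
qed

lemma limit_periodic_limit:
  assumes lp: "limit_periodic f" and c: "c > 0"
    and appr: "\<And>q p \<epsilon>. approximant f q p \<epsilon> \<Longrightarrow>
      \<exists>g b \<beta>. \<beta> \<le> c * \<epsilon> \<and> (\<forall>N. \<bar>a N - g N\<bar> \<le> b N) \<and> g \<longlonglongrightarrow> v q p \<and> b \<longlonglongrightarrow> \<beta>"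
  obtains x where "a \<longlonglongrightarrow> x" "\<And>q p \<epsilon>. approximant f q p \<epsilon> \<Longrightarrow> \<bar>x - v q p\<bar> \<le> c * \<epsilon>"
proof -
  have "convergent a"
  proof (rule approximable_convergent)
    fix \<epsilon> :: real assume "\<epsilon> > 0"
    then have "\<epsilon> / c > 0" using c by simp
    then obtain q p where "approximant f q p (\<epsilon> / c)" using lp unfolding limit_periodic_def by blast
    from appr[OF this] show "\<exists>g b v \<beta>. \<beta> \<le> \<epsilon> \<and> (\<forall>N. \<bar>a N - g N\<bar> \<le> b N) \<and> g \<longlonglongrightarrow> v \<and> b \<longlonglongrightarrow> \<beta>"
      using c by auto
  qed
  then obtain x where x: "a \<longlonglongrightarrow> x" by (auto simp: convergent_def)
  have "\<bar>x - v q p\<bar> \<le> c * \<epsilon>" if ap: "approximant f q p \<epsilon>" for q p \<epsilon>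
  proof -
    obtain g b \<beta> where g: "\<beta> \<le> c * \<epsilon>" "\<And>N. \<bar>a N - g N\<bar> \<le> b N" "g \<longlonglongrightarrow> v q p" "b \<longlonglongrightarrow> \<beta>"
      using appr[OF ap] by blast
    show ?thesis using close_limits[OF x g(2,3,4)] g(1) by simp
  qed
  with x show thesis by (rule that)
qed

text \<open>The quantitative bound is carried through the induction because, holding uniformly in
  \<open>h\<close>, it makes the averages of the lower powers converge by comparison with periodic
  averages. Each level doubles the error.\<close>

lemma limit_periodic_has_U_power:
  assumes \<Phi>: "folner \<Phi>" and lp: "limit_periodic f"
  shows "\<exists>x. has_U_power \<Phi> k f x \<and>
    (\<forall>q p \<epsilon>. approximant f q p \<epsilon> \<longrightarrow> \<bar>x - cyclic_U_power q k p\<bar> \<le> 2 ^ k * \<epsilon>)"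
  using lp
proof (induction k arbitrary: f)
  case 0
  show ?case
  proof (rule limit_periodic_limit[OF 0, of 1 "\<lambda>N. ravg (\<Phi> N) f" "\<lambda>q p. (\<Sum>n<q. p n) / real q"])
    fix q p \<epsilon> assume "approximant f q p \<epsilon>"
    then obtain b where q: "q > 0" "periodic q p" "\<And>n. \<bar>p n\<bar> \<le> 1"
      and b: "periodic q b" "\<And>n. \<bar>f n - p n\<bar> \<le> b n" "(\<Sum>n<q. b n) \<le> \<epsilon> * real q"
      by (auto simp: approximant_def)
    have "(\<Sum>n<q. b n) / real q \<le> 1 * \<epsilon>" using b(3) q(1) by (simp add: field_simps)
    then show "\<exists>g b \<beta>. \<beta> \<le> 1 * \<epsilon> \<and> (\<forall>N. \<bar>ravg (\<Phi> N) f - g N\<bar> \<le> b N) \<and>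
        g \<longlonglongrightarrow> (\<Sum>n<q. p n) / real q \<and> b \<longlonglongrightarrow> \<beta>"
      using ravg_close[of "\<Phi> N" f p b for N, OF b(2)]
        folner_ravg_periodic[OF \<Phi> q(2,1)] folner_ravg_periodic[OF \<Phi> b(1) q(1)]
      by (intro exI[of _ "\<lambda>N. ravg (\<Phi> N) p"] exI[of _ "\<lambda>N. ravg (\<Phi> N) b"]
          exI[of _ "(\<Sum>n<q. b n) / real q"]) simp
  qed (auto intro!: exI)
next
  case (Suc k)
  have "\<forall>h. \<exists>x. has_U_power \<Phi> k (mdiff h f) x \<and> (\<forall>q p \<epsilon>. approximant (mdiff h f) q p \<epsilon> \<longrightarrow>
      \<bar>x - cyclic_U_power q k p\<bar> \<le> 2 ^ k * \<epsilon>)"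
    using Suc.IH limit_periodic_mdiff[OF Suc.prems] by blast
  then obtain w where w: "\<And>h. has_U_power \<Phi> k (mdiff h f) (w h)"
    "\<And>h q p \<epsilon>. approximant (mdiff h f) q p \<epsilon> \<Longrightarrow> \<bar>w h - cyclic_U_power q k p\<bar> \<le> 2 ^ k * \<epsilon>"
    by metis
  have f: "\<And>n. \<bar>f n\<bar> \<le> 1" using Suc.prems by (simp add: limit_periodic_def)
  obtain x where x: "(\<lambda>H. ravg {1..H} w) \<longlonglongrightarrow> x"
    "\<And>q p \<epsilon>. approximant f q p \<epsilon> \<Longrightarrow> \<bar>x - cyclic_U_power q (Suc k) p\<bar> \<le> 2 ^ Suc k * \<epsilon>"
  proof (rule limit_periodic_limit[OF Suc.prems, of "2 ^ Suc k" "\<lambda>H. ravg {1..H} w"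
        "\<lambda>q p. cyclic_U_power q (Suc k) p"])
    fix q p \<epsilon> assume ap: "approximant f q p \<epsilon>"
    then have q: "q > 0" "periodic q p" by (auto simp: approximant_def)
    have "\<bar>w h - cyclic_U_power q k (mdiff h p)\<bar> \<le> 2 ^ Suc k * \<epsilon>" for h
      using w(2)[OF approximant_mdiff[OF ap f]] by (simp add: mult_ac)
    then have "\<bar>ravg {1..H} w - ravg {1..H} (\<lambda>h. cyclic_U_power q k (mdiff h p))\<bar>
        \<le> ravg {1..H} (\<lambda>h. 2 ^ Suc k * \<epsilon>)" for H
      by (rule ravg_close)
    also have "ravg {1..H} (\<lambda>h. 2 ^ Suc k * \<epsilon>) \<le> 2 ^ Suc k * \<epsilon>" for H
      using approximant_nonneg[OF ap] by (intro ravg_le_const) auto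
    finally have "\<bar>ravg {1..H} w - ravg {1..H} (\<lambda>h. cyclic_U_power q k (mdiff h p))\<bar> \<le> 2 ^ Suc k * \<epsilon>" for H .
    moreover have "(\<lambda>H. ravg {1..H} (\<lambda>h. cyclic_U_power q k (mdiff h p))) \<longlonglongrightarrow> cyclic_U_power q (Suc k) p"
      unfolding cyclic_U_power.simps
      by (rule LIMSEQ_imp_Suc, rule folner_ravg_periodic[OF folner_initial _ q(1)])
        (rule periodic_cyclic_U_power_mdiff[OF q(2)])
    ultimately show "\<exists>g b \<beta>. \<beta> \<le> 2 ^ Suc k * \<epsilon> \<and> (\<forall>H. \<bar>ravg {1..H} w - g H\<bar> \<le> b H) \<and>
        g \<longlonglongrightarrow> cyclic_U_power q (Suc k) p \<and> b \<longlonglongrightarrow> \<beta>"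
      by (intro exI[of _ "\<lambda>H. ravg {1..H} (\<lambda>h. cyclic_U_power q k (mdiff h p))"]
          exI[of _ "\<lambda>H. 2 ^ Suc k * \<epsilon>"] exI[of _ "2 ^ Suc k * \<epsilon>"])
        (simp del: power_Suc cyclic_U_power.simps)
  qed auto
  have "x \<ge> 0"
  proof (rule field_le_epsilon)
    fix e :: real assume "e > 0"
    then have "e / 2 ^ Suc k > 0" by simp
    then obtain q p where ap: "approximant f q p (e / 2 ^ Suc k)"
      using Suc.prems unfolding limit_periodic_def by blast
    then have "periodic q p" by (simp add: approximant_def)
    then have "cyclic_U_power q (Suc k) p \<ge> 0" by (rule cyclic_U_power_nonneg)
    moreover have "\<bar>x - cyclic_U_power q (Suc k) p\<bar> \<le> e" using x(2)[OF ap] by simp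
    ultimately show "0 \<le> x + e" by linarith
  qed
  then show ?case using x w(1) by (intro exI[of _ x]) (auto intro!: exI[of _ w])
qed

section \<open>Periodic approximation and correlations of the Rudin-Shapiro signs\<close>

definition rs_mod :: "nat \<Rightarrow> nat \<Rightarrow> real" where
  "rs_mod M n = rs_sign (n mod 2 ^ M)"

lemma abs_rs_mod [simp]: "\<bar>rs_mod M n\<bar> = 1"
  by (simp add: rs_mod_def)

lemma periodic_rs_mod: "periodic (2 ^ M) (rs_mod M)"
  by (simp add: periodic_def rs_mod_def)

text \<open>Marks the \<open>n\<close> for which adding \<open>h\<close> changes the top one of the
  \<open>M\<close> low digits or overflows them. A change from 1 to 0 requires an overflow, so only
  the change from 0 to 1 is listed.\<close>

definition carries :: "nat \<Rightarrow> nat \<Rightarrow> nat \<Rightarrow> real" where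
  "carries M h n = (let t = n mod 2 ^ M in
     if 2 * t < 2 ^ M \<and> 2 ^ M \<le> 2 * (t + h) \<or> 2 ^ M \<le> t + h then 1 else 0)"

lemma carries_mono: "h \<le> h' \<Longrightarrow> carries M h n \<le> carries M h' n"
  by (auto simp: carries_def Let_def)

lemma carries_cases: "carries M h n = 0 \<or> carries M h n = 1"
  by (auto simp: carries_def Let_def)

lemma periodic_carries: "periodic (2 ^ M) (carries M h)"
  by (simp add: periodic_def carries_def)

lemma sum_carries: "(\<Sum>n<2 ^ M. carries M h n) \<le> 2 * real h"
proof -
  let ?S = "{n \<in> {..<2 ^ M}. 2 * n < 2 ^ M \<and> 2 ^ M \<le> 2 * (n + h) \<or> 2 ^ M \<le> n + h}"
  \<comment> \<open>Half of \<open>2 ^ M\<close> rounded up; the rounding matters for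
    \<open>M = 0\<close>.\<close>
  define a :: nat where "a = (2 ^ M + 1) div 2"
  have "?S \<subseteq> {a - h..<a} \<union> {2 ^ M - h..<2 ^ M}" by (auto simp: a_def)
  then have "card ?S \<le> card ({a - h..<a} \<union> {2 ^ M - h..<2 ^ M})" by (intro card_mono) auto
  also have "\<dots> \<le> card {a - h..<a} + card {2 ^ M - h..<2 ^ M}" by (rule card_Un_le)
  also have "\<dots> \<le> 2 * h" by simp
  finally have "real (card ?S) \<le> real (2 * h)" by (rule of_nat_mono)
  moreover have "(\<Sum>n<2 ^ M. carries M h n) = (\<Sum>n\<in>?S. 1)"
    unfolding sum.inter_filter[OF finite_lessThan] by (intro sum.cong) (auto simp: carries_def)
  ultimately show ?thesis by simp
qed

text \<open>Without a carry \<open>n\<close> and \<open>n + h\<close> have the same high part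
  \<open>Y\<close>, and their low parts the same top digit, so the sign of \<open>Y\<close> and the
  sign at the cut both square to 1.\<close>

lemma rs_sign_mult_shift:
  assumes "carries M h n = 0"
  shows "rs_sign n * rs_sign (n + h) = rs_mod M n * rs_mod M (n + h)"
proof -
  define t Y where "t = n mod 2 ^ M" and "Y = n div 2 ^ M"
  have n: "n = t + 2 ^ M * Y" by (simp add: t_def Y_def)
  have t: "t < 2 ^ M" by (simp add: t_def)
  have nc: "\<not> (2 * t < 2 ^ M \<and> 2 ^ M \<le> 2 * (t + h))" "t + h < 2 ^ M"
    using assms by (auto simp: carries_def t_def Let_def split: if_splits)
  have nh: "n + h = (t + h) + 2 ^ M * Y" by (simp add: n)
  let ?e = "\<lambda>u. if 2 ^ M \<le> 2 * u \<and> odd Y then - 1 else 1 :: real"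
  have "?e (t + h) = ?e t" using nc(1) by auto
  then have "rs_sign n * rs_sign (n + h) = rs_sign t * rs_sign (t + h) * (rs_sign Y * rs_sign Y) * (?e t * ?e t)"
    unfolding nh unfolding n rs_sign_split[OF t] rs_sign_split[OF nc(2)] by (simp only: mult_ac)
  also have "?e t * ?e t = 1" by simp
  finally have "rs_sign n * rs_sign (n + h) = rs_sign t * rs_sign (t + h)" by simp
  moreover have "rs_mod M n = rs_sign t" "rs_mod M (n + h) = rs_sign (t + h)"
    unfolding rs_mod_def nh using nc(2) t n by simp_all
  ultimately show ?thesis by simp
qed

lemma approximant_mdiff_rs_sign:
  "approximant (mdiff h rs_sign) (2 ^ M) (mdiff h (rs_mod M)) (4 * real h / 2 ^ M)"
  unfolding approximant_def
proof (intro conjI allI exI[of _ "\<lambda>n. 2 * carries M h n"])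
  show "\<bar>mdiff h (rs_mod M) n\<bar> \<le> 1" for n by (rule abs_mdiff_le_1) simp
  show "\<bar>mdiff h rs_sign n - mdiff h (rs_mod M) n\<bar> \<le> 2 * carries M h n" for n
  proof (cases "carries M h n = 0")
    case True
    then show ?thesis by (simp add: mdiff_def rs_sign_mult_shift)
  next
    case False
    moreover have "\<bar>mdiff h rs_sign n\<bar> \<le> 1" "\<bar>mdiff h (rs_mod M) n\<bar> \<le> 1"
      by (rule abs_mdiff_le_1, simp)+
    ultimately show ?thesis using carries_cases[of M h n] by simp
  qed
  show "(\<Sum>n<2 ^ M. 2 * carries M h n) \<le> 4 * real h / 2 ^ M * real (2 ^ M)"
    using sum_carries[of M h] by (simp flip: sum_distrib_left)
  show "periodic (2 ^ M) (mdiff h (rs_mod M))" by (intro periodic_mdiff periodic_rs_mod)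
  show "periodic (2 ^ M) (\<lambda>n. 2 * carries M h n)"
    using periodic_carries[of M h] by (simp add: periodic_def)
qed simp

lemma ex_power2_ratio_le:
  assumes "(\<epsilon>::real) > 0"
  shows "\<exists>M. c / 2 ^ M \<le> \<epsilon>"
proof -
  obtain M where "c / \<epsilon> < 2 ^ M" using real_arch_pow[of 2] by auto
  then show ?thesis using assms by (intro exI[of _ M]) (simp add: field_simps)
qed

lemma limit_periodic_mdiff_rs_sign: "limit_periodic (mdiff h rs_sign)"
  unfolding limit_periodic_def
proof (intro conjI allI impI)
  show "\<bar>mdiff h rs_sign n\<bar> \<le> 1" for n by (rule abs_mdiff_le_1) simp
  fix \<epsilon> :: real assume "\<epsilon> > 0"
  then obtain M where "4 * real h / 2 ^ M \<le> \<epsilon>" using ex_power2_ratio_le by blast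
  then have "4 * real h / 2 ^ M * real (2 ^ M) \<le> \<epsilon> * real (2 ^ M)" by (intro mult_right_mono) auto
  then have "approximant (mdiff h rs_sign) (2 ^ M) (mdiff h (rs_mod M)) \<epsilon>"
    using approximant_mdiff_rs_sign[of h M] unfolding approximant_def by (blast intro: order.trans)
  then show "\<exists>q p. approximant (mdiff h rs_sign) q p \<epsilon>" by blast
qed

text \<open>Away from carries all factors are functions of the single sign \<open>rs_sign n\<close> with periodic
  coefficients, and every function of a sign is affine in it.\<close>
lemma rs_sign_correlations_converge:
  fixes F :: "real \<Rightarrow> real"
  assumes \<Phi>: "folner \<Phi>" and I: "finite I"
    and F: "\<And>x. x = 1 \<or> x = -1 \<Longrightarrow> 0 \<le> F x \<and> F x \<le> 1"
  shows "convergent (\<lambda>N. ravg (\<Phi> N) (\<lambda>n. \<Prod>i\<in>I. F (rs_sign (n + h i))))"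
proof (rule approximable_convergent)
  fix \<epsilon> :: real assume "\<epsilon> > 0"
  define D where "D = (\<Sum>i\<in>I. h i)"
  obtain M where M: "2 * real D / 2 ^ M \<le> \<epsilon>" using ex_power2_ratio_le[OF \<open>\<epsilon> > 0\<close>] by blast
  define G where "G x n = (\<Prod>i\<in>I. F (rs_mod M n * rs_mod M (n + h i) * x))" for x n
  \<comment> \<open>\<open>u\<close> and \<open>v\<close> are the coefficients of the affine
    function through \<open>G 1\<close> and \<open>G (-1)\<close>; the part with \<open>v\<close>
    averages to 0 against the sign, leaving the mean of \<open>u\<close>.\<close>
  define u where "u n = (G 1 n + G (-1) n) / 2" for n
  define v where "v n = (G 1 n - G (-1) n) / 2" for n
  have rs_mod_cases: "rs_mod M n = 1 \<or> rs_mod M n = -1" for n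
    unfolding rs_mod_def by (rule rs_sign_cases)
  have G: "0 \<le> G x n \<and> G x n \<le> 1" if "x = 1 \<or> x = -1" for x n
  proof -
    have "rs_mod M n * rs_mod M (n + h i) * x = 1 \<or> rs_mod M n * rs_mod M (n + h i) * x = -1" for i
      using rs_mod_cases[of n] rs_mod_cases[of "n + h i"] that by auto
    from F[OF this] show ?thesis
      unfolding G_def by (intro conjI prod_nonneg prod_le_1) auto
  qed
  have Gs: "u n + v n * rs_sign n = G (rs_sign n) n" for n
    using rs_sign_cases[of n] by (auto simp: u_def v_def field_simps)
  have Gper: "periodic (2 ^ M) (G x)" for x
    using periodicD[OF periodic_shift[OF periodic_rs_mod]] periodicD[OF periodic_rs_mod]
    by (simp add: periodic_def G_def)
  have close: "\<bar>(\<Prod>i\<in>I. F (rs_sign (n + h i))) - (u n + v n * rs_sign n)\<bar> \<le> carries M D n" for n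
  proof (cases "carries M D n = 0")
    case True
    have "rs_sign (n + h i) = rs_mod M n * rs_mod M (n + h i) * rs_sign n" if "i \<in> I" for i
    proof -
      have "h i \<le> D" unfolding D_def using that I by (intro member_le_sum) auto
      then have "carries M (h i) n = 0"
        using carries_mono[of "h i" D M n] carries_cases[of M "h i" n] True by auto
      from rs_sign_mult_shift[OF this] have "rs_mod M n * rs_mod M (n + h i) * rs_sign n =
        (rs_sign n * rs_sign n) * rs_sign (n + h i)" by (simp only: mult_ac)
      then show ?thesis by simp
    qed
    then have "(\<Prod>i\<in>I. F (rs_sign (n + h i))) = G (rs_sign n) n"
      unfolding G_def by (intro prod.cong) auto
    then show ?thesis using True by (simp add: Gs)
  next
    case False
    have "0 \<le> (\<Prod>i\<in>I. F (rs_sign (n + h i))) \<and> (\<Prod>i\<in>I. F (rs_sign (n + h i))) \<le> 1"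
      using F rs_sign_cases by (intro conjI prod_nonneg prod_le_1) auto
    then show ?thesis using G[OF rs_sign_cases, of n n] carries_cases[of M D n] False
      unfolding Gs by auto
  qed
  have uper: "periodic (2 ^ M) u" and vper: "periodic (2 ^ M) v"
    using Gper[of 1] Gper[of "-1"] by (simp_all add: periodic_def u_def v_def)
  have "\<bar>v n\<bar> \<le> 1" for n using G[of 1 n] G[of "-1" n] by (auto simp: v_def)
  then have "(\<lambda>N. ravg (\<Phi> N) (\<lambda>n. v n * rs_sign n)) \<longlonglongrightarrow> 0"
    using uniform_mean_periodic_mult_rs_sign[OF vper]
    by (intro folner_ravg_tendsto[OF \<Phi>, of _ 1]) (auto simp: abs_mult)
  then have "(\<lambda>N. ravg (\<Phi> N) (\<lambda>n. u n + v n * rs_sign n)) \<longlonglongrightarrow> (\<Sum>n<2^M. u n) / real (2^M) + 0"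
    unfolding ravg_add by (intro tendsto_add folner_ravg_periodic[OF \<Phi> uper]) auto
  moreover have "(\<lambda>N. ravg (\<Phi> N) (carries M D)) \<longlonglongrightarrow> (\<Sum>n<2^M. carries M D n) / real (2^M)"
    by (intro folner_ravg_periodic[OF \<Phi> periodic_carries]) auto
  moreover have "(\<Sum>n<2^M. carries M D n) / real (2^M) \<le> \<epsilon>"
    using order.trans[OF divide_right_mono[OF sum_carries[of M D], of "2 ^ M"] M] by simp
  moreover have "\<bar>ravg (\<Phi> N) (\<lambda>n. \<Prod>i\<in>I. F (rs_sign (n + h i))) -
      ravg (\<Phi> N) (\<lambda>n. u n + v n * rs_sign n)\<bar> \<le> ravg (\<Phi> N) (carries M D)" for N
    using close by (rule ravg_close)
  ultimately show "\<exists>g b v \<beta>. \<beta> \<le> \<epsilon> \<and>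
      (\<forall>N. \<bar>ravg (\<Phi> N) (\<lambda>n. \<Prod>i\<in>I. F (rs_sign (n + h i))) - g N\<bar> \<le> b N) \<and> g \<longlonglongrightarrow> v \<and> b \<longlonglongrightarrow> \<beta>"
    by (intro exI[of _ "\<lambda>N. ravg (\<Phi> N) (\<lambda>n. u n + v n * rs_sign n)"]
        exI[of _ "\<lambda>N. ravg (\<Phi> N) (carries M D)"] exI[of _ "(\<Sum>n<2^M. u n) / real (2^M) + 0"]
        exI[of _ "(\<Sum>n<2^M. carries M D n) / real (2^M)"]) simp
qed

section \<open>Cancellation in cube averages\<close>

text \<open>A cube is listed as \<open>[h\<^sub>1, \<dots>, h\<^sub>k, n]\<close>, with the base point last.\<close>
fun cube :: "(nat \<Rightarrow> real) \<Rightarrow> nat list \<Rightarrow> real" where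
  "cube f [] = 1"
| "cube f [n] = f n"
| "cube f (h # v # vs) = cube (mdiff h f) (v # vs)"

lemma cube_Cons: "vs \<noteq> [] \<Longrightarrow> cube f (h # vs) = cube (mdiff h f) vs"
  by (cases vs) auto

lemma abs_cube:
  assumes "\<And>n. \<bar>f n\<bar> = 1"
  shows "\<bar>cube f vs\<bar> = 1"
  using assms by (induction f vs rule: cube.induct) (auto simp: mdiff_def abs_mult)

definition box :: "nat \<Rightarrow> nat \<Rightarrow> nat list set" where
  "box T d = {xs. set xs \<subseteq> {..<T} \<and> length xs = d}"

lemma finite_box [simp]: "finite (box T d)"
  by (simp add: box_def finite_lists_length_eq)

lemma card_box: "card (box T d) = T ^ d"
  by (simp add: box_def card_lists_length_eq)

lemma box_0 [simp]: "box T 0 = {[]}"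
  by (auto simp: box_def)

lemma length_box: "xs \<in> box T d \<Longrightarrow> length xs = d"
  by (simp add: box_def)

lemma sum_box_Suc:
  fixes F :: "nat list \<Rightarrow> 'a :: comm_monoid_add"
  shows "(\<Sum>xs\<in>box T (Suc d). F xs) = (\<Sum>h<T. \<Sum>xs\<in>box T d. F (h # xs))"
  unfolding sum.cartesian_product
  by (rule sum.reindex_bij_witness[of _ "\<lambda>(h, xs). h # xs" "\<lambda>xs. (hd xs, tl xs)"])
    (auto simp: box_def length_Suc_conv)

lemma cyclic_U_power_eq_sum_cube:
  assumes "q > 0"
  shows "real q ^ Suc k * cyclic_U_power q k p = (\<Sum>xs\<in>box q (Suc k). cube p xs)"
proof (induction k arbitrary: p)
  case 0
  show ?case unfolding sum_box_Suc using assms by simp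
next
  case (Suc k)
  have "real q ^ Suc (Suc k) * cyclic_U_power q (Suc k) p =
      real q ^ Suc k * (\<Sum>h<q. cyclic_U_power q k (mdiff h p))"
    using assms by simp
  also have "\<dots> = (\<Sum>h<q. real q ^ Suc k * cyclic_U_power q k (mdiff h p))"
    by (rule sum_distrib_left)
  also have "\<dots> = (\<Sum>h<q. \<Sum>xs\<in>box q (Suc k). cube p (h # xs))"
    unfolding Suc.IH by (intro sum.cong cube_Cons[symmetric]) (auto simp: box_def)
  finally show ?case unfolding sum_box_Suc[of _ _ "Suc k"] .
qed

text \<open>Coordinatewise gluing of digits: \<open>xs\<close> holds the low digits when its entries
  are below \<open>R\<close>, \<open>ys\<close> the high ones.\<close>

definition comb :: "nat \<Rightarrow> nat list \<Rightarrow> nat list \<Rightarrow> nat list" where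
  "comb R xs ys = map2 (\<lambda>x y. x + R * y) xs ys"

lemma comb_simps [simp]:
  "comb R [] ys = []" "comb R (x # xs) (y # ys) = (x + R * y) # comb R xs ys"
  by (simp_all add: comb_def)

lemma length_comb [simp]: "length (comb R xs ys) = min (length xs) (length ys)"
  by (simp add: comb_def)

lemma comb_comb:
  "\<lbrakk>length xs = length zs; length zs = length ys\<rbrakk> \<Longrightarrow>
     comb (T * U) (comb T xs zs) ys = comb T xs (comb U zs ys)"
  by (induction xs zs ys rule: list_induct3) (auto simp: algebra_simps)

lemma sum_list_comb:
  "length xs = length ys \<Longrightarrow> sum_list (comb R xs ys) = sum_list xs + R * sum_list ys"
  by (induction xs ys rule: list_induct2) (auto simp: algebra_simps)

lemma sum_box_mult:
  fixes F :: "nat list \<Rightarrow> 'a :: comm_monoid_add"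
  shows "(\<Sum>zs\<in>box (T * U) d. F zs) = (\<Sum>ys\<in>box U d. \<Sum>xs\<in>box T d. F (comb T xs ys))"
proof (induction d arbitrary: F)
  case (Suc d)
  have "(\<Sum>zs\<in>box (T * U) (Suc d). F zs) =
      (\<Sum>y<U. \<Sum>x<T. \<Sum>ys\<in>box U d. \<Sum>xs\<in>box T d. F ((x + T * y) # comb T xs ys))"
    unfolding sum_box_Suc sum_blocks Suc.IH ..
  also have "\<dots> = (\<Sum>y<U. \<Sum>ys\<in>box U d. \<Sum>x<T. \<Sum>xs\<in>box T d. F ((x + T * y) # comb T xs ys))"
    by (intro sum.cong sum.swap refl)
  finally show ?case unfolding sum_box_Suc by simp
qed simp

text \<open>Every argument reached by the cube is a sum of some entries, so its low part is at most
  \<open>sum_list xs\<close>; there \<open>f\<close> factors, and the factorisation passes through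
  \<open>mdiff\<close>.\<close>

lemma cube_comb:
  assumes "length xs = length ys" "xs \<noteq> []"
    and "\<And>a c. a \<le> sum_list xs \<Longrightarrow> f (a + R * c) = f1 a * f2 c"
  shows "cube f (comb R xs ys) = cube f1 xs * cube f2 ys"
  using assms
proof (induction xs ys arbitrary: f f1 f2 rule: list_induct2)
  case (Cons x xs y ys)
  show ?case
  proof (cases "xs = []")
    case True
    then show ?thesis using Cons.hyps Cons.prems(2)[of x y] by simp
  next
    case False
    with Cons.hyps have ne: "ys \<noteq> []" "comb R xs ys \<noteq> []" by (auto simp flip: length_greater_0_conv)
    have "mdiff (x + R * y) f (a + R * c) = mdiff x f1 a * mdiff y f2 c" if "a \<le> sum_list xs" for a c
    proof -
      have eq: "a + R * c + (x + R * y) = (a + x) + R * (c + y)" by (simp add: algebra_simps)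
      show ?thesis unfolding mdiff_def eq
        using that Cons.prems(2)[of a c] Cons.prems(2)[of "a + x" "c + y"] by simp
    qed
    from Cons.IH[of "mdiff (x + R * y) f" "mdiff x f1" "mdiff y f2", OF False this]
    show ?thesis using False ne by (simp add: cube_Cons)
  qed
qed simp

lemma rs_mod_concat:
  assumes "2 * A < 2 ^ B" "B \<le> M"
  shows "rs_mod M (A + 2 ^ B * Y) = rs_sign A * rs_mod M (2 ^ B * Y)"
proof -
  have M: "(2::nat) ^ M = 2 ^ B * 2 ^ (M - B)" using assms(2) by (simp flip: power_add)
  have "(A + 2 ^ B * Y) mod 2 ^ M = A + 2 ^ B * (Y mod 2 ^ (M - B))"
    unfolding M mod_mult2_eq using assms(1) by simp
  moreover have "(2 ^ B * Y) mod 2 ^ M = 2 ^ B * (Y mod 2 ^ (M - B))"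
    unfolding M by simp
  ultimately show ?thesis
    unfolding rs_mod_def by (simp only: rs_sign_concat[OF assms(1)] rs_sign_shift)
qed

text \<open>With equal steps the value at \<open>n + j * c\<close> occurs \<open>k choose j\<close>
  times, and the negative one, \<open>j = k\<close>, exactly once.\<close>

lemma cube_replicate:
  assumes "\<And>j. j < k \<Longrightarrow> f (n + j * c) = 1" "f (n + k * c) = -1"
  shows "cube f (replicate k c @ [n]) = -1"
  using assms
proof (induction k arbitrary: f)
  case (Suc k)
  have "mdiff c f (n + j * c) = f (n + j * c) * f (n + Suc j * c)" for j
    by (simp add: mdiff_def add_ac)
  then have "cube (mdiff c f) (replicate k c @ [n]) = -1"
    using Suc.prems(1)[of j for j] Suc.prems(1)[of "Suc j" for j] Suc.prems(2)
    by (intro Suc.IH) auto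
  then show ?case by (simp add: cube_Cons)
qed simp

lemma ex_negative_cube: "\<exists>z. length z = Suc k \<and> cube rs_sign z = -1"
proof (cases "odd k")
  case True
  then obtain c where "\<And>j. j < k \<Longrightarrow> rs_sign (j * c) = 1" "rs_sign (k * c) = -1"
    using ex_isolating_multiplier by blast
  then have "cube rs_sign (replicate k c @ [0]) = -1" by (intro cube_replicate) auto
  then show ?thesis by (intro exI[of _ "replicate k c @ [0]"]) auto
next
  \<comment> \<open>For even \<open>k\<close> the base point \<open>c\<close> shifts the progression
    to the multiples 1, ..., \<open>k + 1\<close> of \<open>c\<close>, whose last index is
    odd.\<close>
  case False
  then have "odd (Suc k)" by simp
  then obtain c where c: "\<And>j. j < Suc k \<Longrightarrow> rs_sign (j * c) = 1" "rs_sign (Suc k * c) = -1"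
    using ex_isolating_multiplier by blast
  have "cube rs_sign (replicate k c @ [c]) = -1"
    using c(1)[of "Suc j" for j] c(2) by (intro cube_replicate) auto
  then show ?thesis by (intro exI[of _ "replicate k c @ [c]"]) auto
qed

definition low_sum :: "nat \<Rightarrow> nat \<Rightarrow> nat \<Rightarrow> nat list \<Rightarrow> real" where
  "low_sum M d l ys = (\<Sum>xs\<in>box (2 ^ l) d. cube (rs_mod M) (comb (2 ^ l) xs ys))"

text \<open>The zero window pattern and a pattern padded with zeros on both sides and carrying a
  negative cube contribute opposite amounts: the padding absorbs the carries from below and
  keeps the window from interacting with the digits above.\<close>
lemma ex_cancelling_window:
  assumes d: "d \<ge> 1"
  obtains w Z0 Z1 where "w \<ge> 1" "Z0 \<in> box (2 ^ w) d" "Z1 \<in> box (2 ^ w) d" "Z0 \<noteq> Z1"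
    "\<And>M l ys. \<lbrakk>l + w \<le> M; length ys = d\<rbrakk> \<Longrightarrow>
       low_sum M d l (comb (2 ^ w) Z1 ys) = - low_sum M d l (comb (2 ^ w) Z0 ys)"
proof -
  obtain z where z: "length z = d" "cube rs_sign z = -1"
    using ex_negative_cube[of "d - 1"] d by auto
  define z0 where "z0 = replicate d (0::nat)"
  have "f 0 = 1 \<Longrightarrow> cube f (replicate (Suc e) 0) = 1" for f e
    by (induction e arbitrary: f) (simp_all add: mdiff_def)
  from this[of rs_sign "d - 1"] have z0: "length z0 = d" "cube rs_sign z0 = 1"
    using d by (simp_all add: z0_def)
  \<comment> \<open>Room for carries from below: \<open>d\<close> numbers under \<open>2 ^ l\<close>
    add up to at most \<open>d * 2 ^ l\<close>, so twice the sum fits under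
    \<open>2 ^ (l + b)\<close>.\<close>
  obtain b where b: "2 * d < 2 ^ b" using ex_power2_gt by blast
  \<comment> \<open>Keeps the top digit of the window zero even in the largest sum, low part
    included, so nothing interacts with \<open>ys\<close>.\<close>
  obtain w where w: "2 * (d + 2 ^ b * sum_list z) < 2 ^ w" using ex_power2_gt by blast
  define pad where "pad = map ((*) (2 ^ b) :: nat \<Rightarrow> nat)"
  have pad_sum: "sum_list (pad v) = 2 ^ b * sum_list v" for v
    by (simp add: pad_def sum_list_const_mult)
  have pad_box: "pad v \<in> box (2 ^ w) d" if "length v = d" "sum_list v \<le> sum_list z" for v
  proof -
    have "x < 2 ^ w" if "x \<in> set (pad v)" for x
    proof -
      have "x \<le> sum_list (pad v)" using that by (intro member_le_sum_list) auto
      also have "\<dots> \<le> 2 ^ b * sum_list z" using \<open>sum_list v \<le> sum_list z\<close> by (simp add: pad_sum)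
      finally show ?thesis using w by simp
    qed
    then show ?thesis using that by (auto simp: box_def pad_def)
  qed
  \<comment> \<open>The pattern enters only through \<open>cube rs_sign v\<close>; the remaining sum
    is common to both patterns, which carry the values 1 and -1.\<close>
  have val: "low_sum M d l (comb (2 ^ w) (pad v) ys) = cube rs_sign v *
      (\<Sum>xs\<in>box (2 ^ l) d. cube rs_sign xs * cube (\<lambda>Y. rs_mod M (2 ^ (l + w) * Y)) ys)"
    if M: "l + w \<le> M" and ys: "length ys = d" and v: "length v = d" "sum_list v \<le> sum_list z" for M l ys v
    unfolding low_sum_def sum_distrib_left
  proof (intro sum.cong refl)
    fix xs assume xs: "xs \<in> box (2 ^ l) d"
    have lxs: "length xs = d" using xs by (rule length_box)
    have lp: "length (pad v) = d" using v by (simp add: pad_def)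
    have ne: "xs \<noteq> []" using lxs d by auto
    have sxs: "sum_list xs \<le> d * 2 ^ l"
    proof -
      have "sum_list xs \<le> sum_list (map (\<lambda>_. 2 ^ l) xs)"
        using xs sum_list_mono[of xs "\<lambda>x. x" "\<lambda>_. 2 ^ l"]
        by (auto simp: box_def subset_iff intro: less_imp_le)
      then show ?thesis using lxs by (simp add: sum_list_triv)
    qed
    have low: "cube rs_sign (comb (2 ^ l) xs (pad v)) = cube rs_sign xs * cube rs_sign v"
    proof -
      have "comb (2 ^ l) xs (pad v) = comb (2 ^ l * 2 ^ b) xs v"
        using lxs v by (intro nth_equalityI) (auto simp: comb_def pad_def mult.assoc)
      also have "cube rs_sign \<dots> = cube rs_sign xs * cube rs_sign v"
      proof (rule cube_comb)
        fix a c assume "a \<le> sum_list xs"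
        then have "2 * a \<le> 2 * d * 2 ^ l" using sxs by simp
        also have "\<dots> < 2 ^ b * 2 ^ l" using b by simp
        finally have "2 * a < 2 ^ (l + b)" by (simp add: power_add mult.commute)
        from rs_sign_concat[OF this] show "rs_sign (a + 2 ^ l * 2 ^ b * c) = rs_sign a * rs_sign c"
          by (simp add: power_add)
      qed (use lxs v ne in auto)
      finally show ?thesis .
    qed
    have "comb (2 ^ l) xs (comb (2 ^ w) (pad v) ys) = comb (2 ^ (l + w)) (comb (2 ^ l) xs (pad v)) ys"
      using comb_comb[of xs "pad v" ys "2 ^ l" "2 ^ w"] lxs lp ys by (simp add: power_add)
    also have "cube (rs_mod M) \<dots> =
        cube rs_sign (comb (2 ^ l) xs (pad v)) * cube (\<lambda>Y. rs_mod M (2 ^ (l + w) * Y)) ys"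
    proof (rule cube_comb)
      fix a c assume "a \<le> sum_list (comb (2 ^ l) xs (pad v))"
      also have "\<dots> = sum_list xs + 2 ^ l * (2 ^ b * sum_list v)"
        using lxs lp by (simp add: sum_list_comb pad_sum)
      also have "\<dots> \<le> d * 2 ^ l + 2 ^ l * (2 ^ b * sum_list z)"
        using sxs v by (intro add_mono mult_le_mono) auto
      finally have "2 * a \<le> 2 ^ l * (2 * (d + 2 ^ b * sum_list z))" by (simp add: algebra_simps)
      also have "\<dots> < 2 ^ l * 2 ^ w" using w by simp
      finally have "2 * a < 2 ^ (l + w)" by (simp add: power_add)
      then show "rs_mod M (a + 2 ^ (l + w) * c) = rs_sign a * rs_mod M (2 ^ (l + w) * c)"
        using M by (rule rs_mod_concat)
    qed (use lxs lp ys ne d in \<open>auto simp flip: length_greater_0_conv\<close>)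
    finally show "cube (rs_mod M) (comb (2 ^ l) xs (comb (2 ^ w) (pad v) ys)) = cube rs_sign v *
        (cube rs_sign xs * cube (\<lambda>Y. rs_mod M (2 ^ (l + w) * Y)) ys)"
      unfolding low by (simp only: mult_ac)
  qed
  have s0: "sum_list z0 \<le> sum_list z" by (simp add: z0_def sum_list_replicate)
  show thesis
  proof (rule that[of w "pad z0" "pad z"])
    show "w \<ge> 1" using w d by (cases w) auto
    show "pad z0 \<noteq> pad z"
      using z z0 by (auto simp: pad_def inj_map_eq_map inj_on_def)
    show "pad z0 \<in> box (2 ^ w) d" "pad z \<in> box (2 ^ w) d"
      using pad_box z(1) z0(1) s0 by auto
    show "low_sum M d l (comb (2 ^ w) (pad z) ys) = - low_sum M d l (comb (2 ^ w) (pad z0) ys)"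
      if "l + w \<le> M" "length ys = d" for M l ys
      using val[OF that z(1)] val[OF that z0(1) s0] z(2) z0(2) by simp
  qed
qed

text \<open>The windows are peeled off from the top. Of the \<open>2 ^ (w * d)\<close> patterns in a
  window, two cancel, and each of the others leaves a sum over \<open>J\<close> lower windows with
  the pattern joined to \<open>ys\<close>.\<close>

lemma low_sum_bound:
  assumes d: "d \<ge> 1"
  obtains w where "w \<ge> 1"
    "\<And>M J ys. \<lbrakk>w * J \<le> M; length ys = d\<rbrakk> \<Longrightarrow> \<bar>low_sum M d (w * J) ys\<bar> \<le> (2 ^ (w * d) - 2) ^ J"
proof -
  obtain w Z0 Z1 where w: "w \<ge> 1" and Z: "Z0 \<in> box (2 ^ w) d" "Z1 \<in> box (2 ^ w) d" "Z0 \<noteq> Z1"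
    and canc: "\<And>M l ys. \<lbrakk>l + w \<le> M; length ys = d\<rbrakk> \<Longrightarrow>
       low_sum M d l (comb (2 ^ w) Z1 ys) = - low_sum M d l (comb (2 ^ w) Z0 ys)"
    using ex_cancelling_window[OF d] by metis
  have "\<bar>low_sum M d (w * J) ys\<bar> \<le> (2 ^ (w * d) - 2) ^ J" if "w * J \<le> M" "length ys = d" for M J ys
    using that
  proof (induction J arbitrary: ys)
    case 0
    have "\<bar>low_sum M d 0 ys\<bar> \<le> real (card (box 1 d)) * 1"
      unfolding low_sum_def power_0
      by (rule order.trans[OF sum_abs sum_bounded_above]) (simp add: abs_cube)
    then show ?case by (simp add: card_box)
  next
    case (Suc J)
    define l where "l = w * J"
    have l: "w * Suc J = l + w" "l + w \<le> M" using Suc.prems by (simp_all add: l_def)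
    let ?Q = "\<lambda>zs. low_sum M d l (comb (2 ^ w) zs ys)"
    have "low_sum M d (l + w) ys = (\<Sum>zs\<in>box (2 ^ w) d. ?Q zs)"
      unfolding low_sum_def power_add sum_box_mult
      using Suc.prems(2) by (intro sum.cong refl) (simp add: comb_comb length_box)
    also have "\<dots> = (\<Sum>zs\<in>box (2 ^ w) d - {Z0, Z1}. ?Q zs) + (\<Sum>zs\<in>{Z0, Z1}. ?Q zs)"
      using Z by (intro sum.subset_diff) auto
    also have "(\<Sum>zs\<in>{Z0, Z1}. ?Q zs) = 0"
      using Z(3) canc[OF l(2) Suc.prems(2)] by simp
    finally have "\<bar>low_sum M d (l + w) ys\<bar> = \<bar>\<Sum>zs\<in>box (2 ^ w) d - {Z0, Z1}. ?Q zs\<bar>" by simp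
    also have "\<dots> \<le> real (card (box (2 ^ w) d - {Z0, Z1})) * (2 ^ (w * d) - 2) ^ J"
      unfolding l_def using Suc.prems
      by (intro order.trans[OF sum_abs sum_bounded_above] Suc.IH) (auto simp: length_box)
    also have "real (card (box (2 ^ w) d - {Z0, Z1})) = 2 ^ (w * d) - 2"
    proof -
      have "card (box (2 ^ w) d) \<ge> card {Z0, Z1}" using Z by (intro card_mono) auto
      then show ?thesis using Z by (simp add: card_Diff_subset card_box power_mult)
    qed
    finally show ?case unfolding l(1) by simp
  qed
  with w show thesis by (rule that)
qed

text \<open>With \<open>d = k + 2\<close> the step \<open>h\<close> is the first coordinate: its low
  digits vary and its high part is \<open>j\<close>. Splitting the other coordinates at the same
  digit turns the block sum into a sum of \<open>low_sum\<close> values, each of relative size at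
  most \<open>\<theta> ^ J\<close>.\<close>

lemma cyclic_U_power_block_bound:
  obtains w \<theta> where "w \<ge> 1" "0 \<le> \<theta>" "\<theta> < 1"
    "\<And>M J j. w * J \<le> M \<Longrightarrow>
      \<bar>\<Sum>h<2 ^ (w * J). cyclic_U_power (2 ^ M) k (mdiff (h + 2 ^ (w * J) * j) (rs_mod M))\<bar>
        \<le> \<theta> ^ J * 2 ^ (w * J)"
proof -
  define d where "d = Suc (Suc k)"
  obtain w where w: "w \<ge> 1" and bd:
    "\<And>M J ys. \<lbrakk>w * J \<le> M; length ys = d\<rbrakk> \<Longrightarrow> \<bar>low_sum M d (w * J) ys\<bar> \<le> (2 ^ (w * d) - 2) ^ J"
    using low_sum_bound[of d] by (auto simp: d_def)
  \<comment> \<open>Proportion of window patterns left after the cancellation; it depends neither on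
    \<open>M\<close> nor on \<open>j\<close>.\<close>
  define \<theta> :: real where "\<theta> = (2 ^ (w * d) - 2) / 2 ^ (w * d)"
  have wd: "(2::real) ^ 1 \<le> 2 ^ (w * d)" using w by (intro power_increasing) (auto simp: d_def)
  show thesis
  proof (rule that[OF w, of \<theta>])
    show "0 \<le> \<theta>" "\<theta> < 1" using wd by (simp_all add: \<theta>_def)
    fix M J j assume M: "w * J \<le> M"
    define T U :: nat where "T = 2 ^ (w * J)" and "U = 2 ^ (M - w * J)"
    have TU: "2 ^ M = T * U" unfolding T_def U_def using M by (simp flip: power_add)
    have T0: "T > 0" and U0: "U > 0" by (simp_all add: T_def U_def)
    let ?S = "\<Sum>h<T. cyclic_U_power (2 ^ M) k (mdiff (h + T * j) (rs_mod M))"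
    have "real (2 ^ M) ^ Suc k * ?S =
        (\<Sum>h<T. \<Sum>zs\<in>box (T * U) (Suc k). cube (rs_mod M) ((h + T * j) # zs))"
      unfolding sum_distrib_left
    proof (intro sum.cong refl)
      fix h
      show "real (2 ^ M) ^ Suc k * cyclic_U_power (2 ^ M) k (mdiff (h + T * j) (rs_mod M)) =
          (\<Sum>zs\<in>box (T * U) (Suc k). cube (rs_mod M) ((h + T * j) # zs))"
        using cyclic_U_power_eq_sum_cube[of "2 ^ M" k "mdiff (h + T * j) (rs_mod M)"]
        unfolding TU using T0 U0
        by (simp del: power_Suc) (rule sum.cong[OF refl cube_Cons[symmetric]], auto simp: box_def)
    qed
    also have "\<dots> = (\<Sum>ys\<in>box U (Suc k). \<Sum>h<T. \<Sum>xs\<in>box T (Suc k).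
        cube (rs_mod M) ((h + T * j) # comb T xs ys))"
      unfolding sum_box_mult by (rule sum.swap)
    also have "\<dots> = (\<Sum>ys\<in>box U (Suc k). low_sum M d (w * J) (j # ys))"
      unfolding low_sum_def d_def sum_box_Suc[of _ _ "Suc k"] T_def[symmetric] by simp
    finally have "\<bar>real (2 ^ M) ^ Suc k * ?S\<bar> \<le> real (card (box U (Suc k))) * (2 ^ (w * d) - 2) ^ J"
      by (simp only:) (rule order.trans[OF sum_abs sum_bounded_above],
        rule bd[OF M], simp add: length_box d_def)
    then have "real U ^ Suc k * (real T ^ Suc k * \<bar>?S\<bar>) \<le> real U ^ Suc k * (2 ^ (w * d) - 2) ^ J"
      unfolding TU by (simp add: card_box abs_mult power_mult_distrib mult_ac)
    then have "real T ^ Suc k * \<bar>?S\<bar> \<le> (2 ^ (w * d) - 2) ^ J"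
      using U0 by (simp del: power_Suc)
    also have "\<dots> = real T ^ Suc k * (\<theta> ^ J * T)"
    proof -
      have "(2 ^ (w * d)) ^ J = real T ^ Suc k * T"
        by (simp add: T_def d_def algebra_simps flip: power_mult power_add power_Suc2)
      then show ?thesis by (simp add: \<theta>_def power_divide T_def)
    qed
    finally show "\<bar>\<Sum>h<2 ^ (w * J). cyclic_U_power (2 ^ M) k (mdiff (h + 2 ^ (w * J) * j) (rs_mod M))\<bar>
        \<le> \<theta> ^ J * 2 ^ (w * J)"
      using T0 by (simp add: T_def del: power_Suc)
  qed
qed

section \<open>Uniformity of the Rudin-Shapiro classes\<close>

text \<open>The approximation theory is applied to the derivatives of \<open>rs_sign\<close>, so the
  outermost average over \<open>h\<close> is treated directly: on aligned blocks the values
  \<open>w h\<close> are compared with cyclic powers, whose block sums are small.\<close>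

lemma has_U_power_rs_sign:
  assumes \<Phi>: "folner \<Phi>"
  shows "has_U_power \<Phi> (Suc k) rs_sign 0"
proof -
  obtain w where w: "\<And>h. has_U_power \<Phi> k (mdiff h rs_sign) (w h)"
    and wa: "\<And>h q p \<epsilon>. approximant (mdiff h rs_sign) q p \<epsilon> \<Longrightarrow> \<bar>w h - cyclic_U_power q k p\<bar> \<le> 2 ^ k * \<epsilon>"
    using limit_periodic_has_U_power[OF \<Phi> limit_periodic_mdiff_rs_sign] by metis
  have bounded: "\<bar>w h\<bar> \<le> 2" for h
  proof -
    obtain q p where ap: "approximant (mdiff h rs_sign) q p (1 / 2 ^ k)"
      using limit_periodic_mdiff_rs_sign[of h] unfolding limit_periodic_def
      by (meson zero_less_divide_1_iff zero_less_numeral zero_less_power)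
    then have "\<bar>cyclic_U_power q k p\<bar> \<le> 1"
      by (intro abs_cyclic_U_power_le_1) (simp add: approximant_def)
    with wa[OF ap] show ?thesis by simp
  qed
  obtain m \<theta> where \<theta>: "m \<ge> 1" "0 \<le> \<theta>" "\<theta> < 1"
    and V: "\<And>M J j. m * J \<le> M \<Longrightarrow>
      \<bar>\<Sum>h<2 ^ (m * J). cyclic_U_power (2 ^ M) k (mdiff (h + 2 ^ (m * J) * j) (rs_mod M))\<bar>
        \<le> \<theta> ^ J * 2 ^ (m * J)"
    using cyclic_U_power_block_bound[of k] by metis
  have "uniform_mean w 0"
  proof (rule uniform_mean_0_aligned[OF bounded])
    fix \<epsilon> :: real assume "\<epsilon> > 0"
    then obtain J where J: "\<theta> ^ J < \<epsilon>" using real_arch_pow_inv[OF _ \<theta>(3)] by blast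
    define T :: nat where "T = 2 ^ (m * J)"
    have "\<bar>\<Sum>h<T. w (h + T * j)\<bar> \<le> \<epsilon> * real T" for j
    proof (rule field_le_epsilon)
      fix e :: real assume "e > 0"
      \<comment> \<open>Total approximation error over the block, scaled by \<open>2 ^ M\<close>. It
        grows with \<open>j\<close>, so \<open>M\<close> is picked after \<open>j\<close>; the bound
        \<open>\<theta> ^ J\<close> does not involve \<open>M\<close>.\<close>
      define c where "c = (\<Sum>h<T. 2 ^ k * (4 * real (h + T * j)))"
      have c: "c \<ge> 0" unfolding c_def by (intro sum_nonneg) simp
      obtain M0 where M0: "c / 2 ^ M0 \<le> e" using ex_power2_ratio_le[OF \<open>e > 0\<close>] by blast
      define M where "M = max M0 (m * J)"
      have "c / 2 ^ M \<le> c / 2 ^ M0"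
        using c by (intro divide_left_mono) (auto simp: M_def)
      then have M: "m * J \<le> M" "c / 2 ^ M \<le> e" using M0 by (auto simp: M_def)
      let ?V = "\<lambda>h. cyclic_U_power (2 ^ M) k (mdiff (h + T * j) (rs_mod M))"
      have "\<bar>(\<Sum>h<T. w (h + T * j)) - (\<Sum>h<T. ?V h)\<bar> \<le> (\<Sum>h<T. 2 ^ k * (4 * real (h + T * j) / 2 ^ M))"
        unfolding sum_subtractf[symmetric]
        by (intro order.trans[OF sum_abs] sum_mono wa approximant_mdiff_rs_sign)
      also have "\<dots> = c / 2 ^ M" by (simp add: c_def sum_divide_distrib)
      also have "\<dots> \<le> e" by (rule M)
      finally have 1: "\<bar>(\<Sum>h<T. w (h + T * j)) - (\<Sum>h<T. ?V h)\<bar> \<le> e" .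
      have "\<bar>\<Sum>h<T. ?V h\<bar> \<le> \<theta> ^ J * real T" using V[OF M(1), of j] by (simp add: T_def)
      also have "\<dots> \<le> \<epsilon> * real T" using J by (intro mult_right_mono) auto
      finally show "\<bar>\<Sum>h<T. w (h + T * j)\<bar> \<le> \<epsilon> * real T + e" using 1 by linarith
    qed
    then show "\<exists>T>0. \<forall>q. \<bar>\<Sum>t<T. w (t + T * q)\<bar> \<le> \<epsilon> * real T"
      by (intro exI[of _ T]) (auto simp: T_def)
  qed
  then have "(\<lambda>H. ravg {1..H} w) \<longlonglongrightarrow> 0" by (intro initial_ravg_tendsto[OF bounded])
  then show ?thesis using w by auto
qed

lemma U_uniform_RS:
  assumes a: "a \<in> {0, 1}" and \<Phi>: "folner \<Phi>" and k: "k \<ge> 1"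
  shows "U_uniform \<Phi> k (RS a)"
proof -
  define \<eta> :: real where "\<eta> = (-1) ^ a"
  have \<eta>: "\<eta> = 1 \<or> \<eta> = -1" using a by (auto simp: \<eta>_def)
  \<comment> \<open>The indicator is an affine function of the sign, which gives density 1/2 and
    balanced function \<open>\<eta> / 2 * rs_sign\<close>.\<close>
  define F where "F x = 1 / 2 + \<eta> / 2 * x" for x
  have ind: "indicator (RS a) n = F (rs_sign n)" if "n \<ge> 1" for n
    using that RS_iff[OF a, of n] rs_sign_cases[of n] \<eta>
    unfolding \<eta>_def[symmetric] by (auto simp: F_def indicator_def)
  have indc: "indicator (RS a) n = complex_of_real (indicator (RS a) n)" for n
    by (simp add: indicator_def)
  have sub: "\<Phi> N \<subseteq> {1..}" and fin: "finite (\<Phi> N)" and ne: "card (\<Phi> N) > 0" for N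
    using \<Phi> by (auto simp: folner_def card_gt_0_iff)
  have F01: "0 \<le> F x \<and> F x \<le> 1" if "x = 1 \<or> x = -1" for x
    using that \<eta> by (auto simp: F_def)
  have "admits_correlations \<Phi> (indicator (RS a))"
    unfolding admits_correlations_def
  proof (intro conjI allI impI)
    show "bounded (indicator (RS a) ` {1..} :: complex set)"
      by (rule boundedI[of _ 1]) (auto simp: indicator_def)
    fix m :: nat and h e :: "nat \<Rightarrow> nat"
    assume he: "\<forall>i\<in>{1..m}. 1 \<le> h i \<and> e i \<in> {0, 1}"
    have "(cnj ^^ e i) (indicator (RS a) (n + h i)) = complex_of_real (F (rs_sign (n + h i)))"
      if "i \<in> {1..m}" for i n
    proof -
      have "1 \<le> n + h i" "e i = 0 \<or> e i = 1" using he that by (auto simp: trans_le_add2)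
      then show ?thesis using ind[of "n + h i"] unfolding indc by auto
    qed
    then have "(\<lambda>n. \<Prod>i=1..m. (cnj ^^ e i) (indicator (RS a) (n + h i))) =
        (\<lambda>n. complex_of_real (\<Prod>i=1..m. F (rs_sign (n + h i))))"
      by (simp add: fun_eq_iff)
    moreover have "convergent (\<lambda>N. ravg (\<Phi> N) (\<lambda>n. \<Prod>i=1..m. F (rs_sign (n + h i))))"
      by (rule rs_sign_correlations_converge[OF \<Phi> _ F01]) simp_all
    ultimately show "convergent (\<lambda>N. avg (\<Phi> N) (\<lambda>n. \<Prod>i=1..m. (cnj ^^ e i) (indicator (RS a) (n + h i))))"
      by (simp only: avg_of_real convergent_of_real)
  qed
  moreover have "has_density \<Phi> (RS a) (1 / 2)"
  proof -
    have "uniform_mean (\<lambda>n. 1 * rs_sign n) 0"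
      by (rule uniform_mean_periodic_mult_rs_sign[of 0 _ 1]) (simp_all add: periodic_def)
    then have "(\<lambda>N. ravg (\<Phi> N) rs_sign) \<longlonglongrightarrow> 0"
      by (intro folner_ravg_tendsto[OF \<Phi>, of _ 1]) simp_all
    then have "(\<lambda>N. ravg (\<Phi> N) (\<lambda>n. 1 / 2) + \<eta> / 2 * ravg (\<Phi> N) rs_sign) \<longlonglongrightarrow> 1 / 2 + \<eta> / 2 * 0"
      using ne by (intro tendsto_intros) (simp add: ravg_def)
    moreover have "real (card (RS a \<inter> \<Phi> N)) / real (card (\<Phi> N)) =
        ravg (\<Phi> N) (\<lambda>n. 1 / 2) + \<eta> / 2 * ravg (\<Phi> N) rs_sign" for N
    proof -
      have "real (card (RS a \<inter> \<Phi> N)) / real (card (\<Phi> N)) = ravg (\<Phi> N) (indicator (RS a))"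
        unfolding ravg_def using fin[of N] by (simp add: indicator_def of_bool_def sum.If_cases Int_def conj_commute)
      also have "\<dots> = ravg (\<Phi> N) (\<lambda>n. F (rs_sign n))"
        using sub[of N] by (intro ravg_cong ind) auto
      finally show ?thesis unfolding F_def ravg_add ravg_scale .
    qed
    ultimately show ?thesis by (simp add: has_density_def)
  qed
  moreover have "has_U_norm \<Phi> k (\<lambda>n. indicator (RS a) n - complex_of_real (1 / 2)) 0"
  \<comment> \<open>Equality is only available from 1 on: for \<open>a = 0\<close> the two functions
    differ at 0.\<close>
  proof (rule has_U_norm_cong[OF _ sub])
    obtain l where l: "k = Suc l" using k by (cases k) auto
    show "has_U_norm \<Phi> k (\<lambda>n. complex_of_real (\<eta> / 2 * rs_sign n)) 0"
      using has_U_power_imp_has_U_norm[OF has_U_power_scale[OF has_U_power_rs_sign[OF \<Phi>, of l], of "\<eta> / 2"]]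
      unfolding l by simp
    show "complex_of_real (\<eta> / 2 * rs_sign n) = indicator (RS a) n - complex_of_real (1 / 2)"
      if "n \<ge> 1" for n
      unfolding indc ind[OF that] F_def by simp
  qed
  ultimately show ?thesis unfolding U_uniform_def by (intro conjI exI[of _ "1 / 2"]) simp_all
qed

theorem proposition6p10:
  fixes a :: nat
  assumes "a \<in> {0, 1}"
  shows "(\<forall>\<Phi>. folner \<Phi> \<longrightarrow> U_infinity_uniform \<Phi> (RS a)) \<and>
         (\<exists>B :: nat \<Rightarrow> nat set.
            (\<forall>k\<ge>1. B k \<subseteq> {1..} \<and> infinite (B k) \<and> B (Suc k) \<subseteq> B k) \<and>
            (\<Union>k\<in>{1..}. osum (B k) k) \<subseteq> RS a)"
  using U_uniform_RS[OF assms] ex_ordered_sums_in_RS[OF assms]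
  by (simp add: U_infinity_uniform_def)

end
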